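(* Let $a$ and $b$ be two $\mathcal P$-free elements of a $\mathcal P$-tracial algebra $(A,(m_p)_{p\in\mathcal P})$. Then $$\mathcal R[a+b]=\mathcal R[a]\boxplus\mathcal R[b]\qquad\text{and}\qquad \mathcal R[ab]=\mathcal R[a]\boxtimes\mathcal R[b].$$
   Context: Partitions. For $k\ge 0$, $\mathcal P_k$ is the set of partitions of $\{1,\dots,k,1',\dots,k'\}$ ($\mathcal P_0=\{\emptyset\}$) and $\mathcal P=\bigcup_k\mathcal P_k$. A partition is drawn as a diagram with a top row $1,\dots,k$ and a bottom row $1',\dots,k'$. $\mathrm{nc}(p)$ is the number of blocks of $p$; $p\vee p'$ is the finest partition coarser than both; $\mathrm{id}_k=\{\{i,i'\}:1\le i\le k\}$. The cycles of $p$ are the blocks of $p\vee\mathrm{id}_k$. A permutation $\sigma$ is identified with $\{\{i,\sigma(i)'\}\}$. $p\circ p'$ is obtained by putting $p'$ above $p$, identifying the bottom row of $p'$ with the top row of $p$, then erasing the middle row and keeping connections. $p\otimes p'$ is obtained by putting $p'$ to the right of $p$. Set $d(p,p')=\frac{\mathrm{nc}(p)+\mathrm{nc}(p')}{2}-\mathrm{nc}(p\vee p')$ and $p\le p'$ if $d(\mathrm{id}_k,p)+d(p,p')=d(\mathrm{id}_k,p')$ (a partial order). For $I\subset\{1,\dots,k\}$, the extraction $p_I$ is formed by the non-empty intersections of blocks of $p$ with $I\cup I'$, relabelled increasingly. $\mathfrak F_2(p)$ is the set of triples $(p_1,p_2,I)$ with $I\subset\{1,\dots,k\}$, $p_1=p_I$,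 $p_2=p_{\{1,\dots,k\}\setminus I}$ and $\mathrm{nc}(p_1)+\mathrm{nc}(p_2)=\mathrm{nc}(p)$. For $p,p_1\in\mathcal P_k$, $K_p(p_1)$ is the set of $p_2\in\mathcal P_k$ such that $p_1\circ p_2=p$ and $p_1\otimes p_2\le (p\otimes\mathrm{id}_k)\circ\tau$ in $\mathcal P_{2k}$, where $\tau=(1,k+1)\cdots(k,2k)$; $p_1\prec p$ means $K_p(p_1)\neq\emptyset$. Convolutions. $\mathfrak S_k$ acts on $\mathcal P_k$ by $p\mapsto\sigma\circ p\circ\sigma^{-1}$. For linear forms $\phi_1,\phi_2\in\big(\bigoplus_{k\ge0}\mathbb C[\mathcal P_k/\mathfrak S_k]\big)^*$ and $p\in\mathcal P_k$: $(\phi_1\boxplus\phi_2)(p)=\sum_{(p_1,p_2,I)\in\mathfrak F_2(p)}\phi_1(p_1)\phi_2(p_2)$ and $(\phi_1\boxtimes\phi_2)(p)=\sum_{p_1\prec p,\,p_2\in K_p(p_1)}\phi_1(p_1)\phi_2(p_2)$. $\mathcal P$-tracial algebra. For $p\in\mathcal P_k$, $l\ge k$ and $1\le i_1<\dots<i_k\le l$, $\mathrm{Ins}^l_{(i_1,\dots,i_k)}(p)\in\mathcal P_l$ is obtained by relabelling $j\mapsto i_j$, $j'\mapsto i_j'$ in $p$ and adding the blocks $\{i,i'\}$ for $i\notin\{i_1,\dots,i_k\}$. A $\mathcal P$-tracial algebra $(A,(m_p)_{p\in\mathcal P})$ is a (complex) algebra $A$ with $k$-linear forms $m_p:A^k\to\mathbb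 C$ for $p\in\mathcal P_k$ ($m_\emptyset=1$) such that (1) $m_p(a_1,\dots,a_k)=m_{\sigma\circ p\circ\sigma^{-1}}(a_{\sigma^{-1}(1)},\dots,a_{\sigma^{-1}(k)})$ for all $\sigma\in\mathfrak S_k$; (2) $m_p\big(\prod_{i=1}^{n_1}a^{(1)}_i,\dots,\prod_{i=1}^{n_k}a_i^{(k)}\big)=m_{\mathrm{Ins}^{n}_{\mathbf i}(p)\circ\sigma}(a^{(1)}_1,\dots,a^{(1)}_{n_1},\dots,a^{(k)}_1,\dots,a^{(k)}_{n_k})$, with $n=\sum_j n_j$, $\mathbf i=(1,1+n_1,\dots,1+n_1+\dots+n_{k-1})$ and $\sigma=(1,\dots,n_1)(n_1+1,\dots,n_1+n_2)\cdots(n_1+\dots+n_{k-1}+1,\dots,n)$. The $\mathcal P$-cumulants $(\kappa_p)$ are the unique multilinear forms with $m_p=\sum_{p'\in\mathcal P_k,\,p'\le p}\kappa_{p'}$ for all $p\in\mathcal P_k$ ($\kappa_\emptyset=1$). The $\mathcal R$-transform $\mathcal R[a]$ of $a\in A$ is the linear form on $\bigoplus_k\mathbb C[\mathcal P_k/\mathfrak S_k]$ with $\mathcal R[a](p)=\kappa_p(a,\dots,a)$. $\mathcal P$-freeness. Sub-algebras $A_1,A_2$ are $\mathcal P$-free if: (i) for all $k$, $p\in\mathcal P_k$, and $(a_1,\dots,a_k)$ with $a_i\in A_{\epsilon(i)}$, $\epsilon(i)\in\{1,2\}$, if some cycle of $p$ contains $i$ and $j$ with $\epsilon(i)\ne\epsilon(j)$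 then $\kappa_p(a_1,\dots,a_k)=0$; (ii) for $p_1\in\mathcal P_{k_1},p_2\in\mathcal P_{k_2}$, $(a_i)_{i\le k_1}\in A_1^{k_1}$, $(a_i)_{k_1<i\le k_1+k_2}\in A_2^{k_2}$: $\kappa_{p_1\otimes p_2}(a_1,\dots,a_{k_1+k_2})=\kappa_{p_1}(a_1,\dots,a_{k_1})\kappa_{p_2}(a_{k_1+1},\dots,a_{k_1+k_2})$. Elements (or families) are $\mathcal P$-free if the algebras they generate are. *)

theory Defs
  imports
    Complex_Main
    "HOL-Library.Disjoint_Sets"
    "HOL-Library.FuncSet"
    "HOL-Combinatorics.Combinatorics"
begin

section \<open>Partitions of two rows of points\<close>

text \<open>
  Columns are numbered from 0: the top point \<open>i + 1\<close> is \<open>(Top, i)\<close> and the bottom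
  point \<open>(i + 1)'\<close> is \<open>(Bot, i)\<close>. The row \<open>Mid\<close> never occurs in an
  element of \<open>parts k\<close>; it is the row that is erased when diagrams are composed.
\<close>

datatype row = Top | Mid | Bot

type_synonym point = "row \<times> nat"
type_synonym diagram = "point set set"

definition parts :: "nat \<Rightarrow> diagram set" where
  "parts k = {p. partition_on ({Top, Bot} \<times> {..<k}) p}"

definition all_parts :: "diagram set" where
  "all_parts = (\<Union>k. parts k)"

text \<open>The sets \<open>parts k\<close> are pairwise disjoint; \<open>deg p\<close> recovers \<open>k\<close>
  from \<open>p \<in> parts k\<close>.\<close>

definition deg :: "diagram \<Rightarrow> nat" where
  "deg p = card {i. (Top, i) \<in> \<Union>p}"

lemma deg_parts [simp]: "p \<in> parts k \<Longrightarrow> deg p = k"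
proof -
  assume "p \<in> parts k"
  then have "\<Union>p = {Top, Bot} \<times> {..<k}"
    by (simp add: parts_def partition_on_def)
  then have "{i. (Top, i) \<in> \<Union>p} = {..<k}" by auto
  then show ?thesis by (simp add: deg_def)
qed

definition nc :: "diagram \<Rightarrow> nat" where
  "nc p = card p"

text \<open>The connected components of a family of sets: two points are connected if they can be
  joined by a chain of successively intersecting members of the family.\<close>

definition components :: "'b set set \<Rightarrow> 'b set set" where
  "components F = \<Union>F // (\<Union>B\<in>F. B \<times> B)\<^sup>+"

definition join :: "'b set set \<Rightarrow> 'b set set \<Rightarrow> 'b set set"  (infixl \<open>\<or>\<^sub>P\<close> 65) where
  "p \<or>\<^sub>P q = components (p \<union> q)"

lemma equiv_components: "equiv (\<Union>F) ((\<Union>B\<in>F. B \<times> B)\<^sup>+)"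
proof (rule equivI)
  let ?r = "\<Union>B\<in>F. B \<times> B"
  have "?r \<subseteq> \<Union>F \<times> \<Union>F" by auto
  then show "?r\<^sup>+ \<subseteq> \<Union>F \<times> \<Union>F" by (rule trancl_subset_Sigma)
  show "refl_on (\<Union>F) (?r\<^sup>+)" by (auto simp: refl_on_def)
  have "sym ?r" by (auto simp: sym_def)
  then show "sym (?r\<^sup>+)" by (rule sym_trancl)
  show "trans (?r\<^sup>+)" by (rule trans_trancl)
qed

lemma partition_on_components: "partition_on (\<Union>F) (components F)"
  unfolding components_def by (rule partition_on_quotient[OF equiv_components])

lemma components_upper:
  assumes "B \<in> F" "B \<noteq> {}"
  shows "\<exists>C\<in>components F. B \<subseteq> C"
proof -
  let ?r = "(\<Union>B\<in>F. B \<times> B)\<^sup>+"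
  obtain x where x: "x \<in> B" using assms(2) by blast
  have "?r `` {x} \<in> components F"
    unfolding components_def using assms(1) x by (intro quotientI) blast
  moreover have "B \<subseteq> ?r `` {x}" using assms(1) x by blast
  ultimately show ?thesis by blast
qed

lemma components_least:
  assumes S: "partition_on A S" and F: "\<And>B. B \<in> F \<Longrightarrow> \<exists>Y\<in>S. B \<subseteq> Y"
    and C: "C \<in> components F"
  shows "\<exists>Y\<in>S. C \<subseteq> Y"
proof -
  let ?r = "\<Union>B\<in>F. B \<times> B"
  obtain x where x: "x \<in> \<Union>F" and Cx: "C = ?r\<^sup>+ `` {x}"
    using C unfolding components_def by (elim quotientE)
  from x F obtain Y where Y: "Y \<in> S" "x \<in> Y" by blast
  have disj: "Z = Y" if "Z \<in> S" "Z \<inter> Y \<noteq> {}" for Z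
    using S Y(1) that by (auto simp: partition_on_def disjoint_def)
  have "y \<in> Y" if "(x, y) \<in> ?r\<^sup>+" for y
    using that
  proof (induction rule: trancl_induct)
    case (base y)
    then obtain B where B: "B \<in> F" "x \<in> B" "y \<in> B" by auto
    then obtain Z where "Z \<in> S" "B \<subseteq> Z" using F by blast
    then show ?case using disj[of Z] Y B by blast
  next
    case (step y z)
    then obtain B where B: "B \<in> F" "y \<in> B" "z \<in> B" by auto
    then obtain Z where "Z \<in> S" "B \<subseteq> Z" using F by blast
    then show ?case using disj[of Z] Y B step.IH by blast
  qed
  then show ?thesis using Y Cx by blast
qed

text \<open>\<open>p \<or>\<^sub>P q\<close> is the finest partition coarser than both \<open>p\<close> and \<open>q\<close>.\<close>

lemma join_is_finest_coarser:
  assumes p: "partition_on A p" and q: "partition_on A q"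
  shows "refines A p (p \<or>\<^sub>P q)" "refines A q (p \<or>\<^sub>P q)"
    and "\<And>s. refines A p s \<Longrightarrow> refines A q s \<Longrightarrow> refines A (p \<or>\<^sub>P q) s"
proof -
  have A: "\<Union>(p \<union> q) = A" using p q by (auto simp: partition_on_def)
  have j: "partition_on A (p \<or>\<^sub>P q)"
    using partition_on_components[of "p \<union> q"] unfolding A join_def .
  have ne: "B \<noteq> {}" if "B \<in> p \<union> q" for B
    using p q that unfolding partition_on_def by blast
  have up: "\<exists>Y\<in>p \<or>\<^sub>P q. B \<subseteq> Y" if "B \<in> p \<union> q" for B
    using components_upper[OF that ne[OF that]] by (simp add: join_def)
  show "refines A p (p \<or>\<^sub>P q)"
    unfolding refines_def using up p j by (simp add: Ball_def)
  show "refines A q (p \<or>\<^sub>P q)"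
    unfolding refines_def using up q j by (simp add: Ball_def)
  show "refines A (p \<or>\<^sub>P q) s" if s: "refines A p s" "refines A q s" for s
    unfolding refines_def
  proof (intro conjI ballI)
    show "partition_on A (p \<or>\<^sub>P q)" by (rule j)
    show "partition_on A s" using s by (simp add: refines_def)
    then show "\<exists>Y\<in>s. C \<subseteq> Y" if "C \<in> p \<or>\<^sub>P q" for C
    proof (rule components_least)
      show "C \<in> components (p \<union> q)" using that by (simp add: join_def)
      show "\<exists>Y\<in>s. B \<subseteq> Y" if "B \<in> p \<union> q" for B
        using that s unfolding refines_def by blast
    qed
  qed
qed

definition perm_part :: "nat \<Rightarrow> (nat \<Rightarrow> nat) \<Rightarrow> diagram" where
  "perm_part k \<sigma> = {{(Top, i), (Bot, \<sigma> i)} |i. i < k}"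

definition ident :: "nat \<Rightarrow> diagram" where
  "ident k = perm_part k id"

definition cycles :: "diagram \<Rightarrow> diagram" where
  "cycles p = p \<or>\<^sub>P ident (deg p)"

definition relabel :: "(row \<Rightarrow> row) \<Rightarrow> (nat \<Rightarrow> nat) \<Rightarrow> diagram \<Rightarrow> diagram" where
  "relabel f g p = (\<lambda>B. map_prod f g ` B) ` p"

text \<open>In \<open>p \<circ>\<^sub>P q\<close> the diagram \<open>q\<close> occupies the rows \<open>Top\<close>, \<open>Mid\<close> and \<open>p\<close>,
  drawn below it, the rows \<open>Mid\<close>, \<open>Bot\<close>.\<close>

definition comp_part :: "diagram \<Rightarrow> diagram \<Rightarrow> diagram"  (infixl \<open>\<circ>\<^sub>P\<close> 70) where
  "p \<circ>\<^sub>P q =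
    (\<lambda>B. B \<inter> {Top, Bot} \<times> UNIV) `
      components (relabel (\<lambda>r. if r = Bot then Mid else r) id q \<union>
                  relabel (\<lambda>r. if r = Top then Mid else r) id p) - {{}}"

definition tensor :: "diagram \<Rightarrow> diagram \<Rightarrow> diagram"  (infixl \<open>\<otimes>\<^sub>P\<close> 75) where
  "p \<otimes>\<^sub>P q = p \<union> relabel id (\<lambda>i. deg p + i) q"

definition dist_part :: "diagram \<Rightarrow> diagram \<Rightarrow> real" where
  "dist_part p q = (real (nc p) + real (nc q)) / 2 - real (nc (p \<or>\<^sub>P q))"

definition le_part :: "diagram \<Rightarrow> diagram \<Rightarrow> bool"  (infix \<open>\<le>\<^sub>P\<close> 50) where
  "p \<le>\<^sub>P q \<longleftrightarrow>
    dist_part (ident (deg p)) p + dist_part p q = dist_part (ident (deg p)) q"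

text \<open>The map \<open>\<lambda>i. card {j \<in> I. j < i}\<close> is the increasing bijection from \<open>I\<close> onto
  \<open>{..<card I}\<close>.\<close>

definition extraction :: "diagram \<Rightarrow> nat set \<Rightarrow> diagram" where
  "extraction p I =
    relabel id (\<lambda>i. card {j \<in> I. j < i}) ((\<lambda>B. B \<inter> {Top, Bot} \<times> I) ` p - {{}})"

definition F2 :: "diagram \<Rightarrow> (diagram \<times> diagram \<times> nat set) set" where
  "F2 p = {(p1, p2, I). I \<subseteq> {..<deg p} \<and> p1 = extraction p I \<and> p2 = extraction p ({..<deg p} - I)
             \<and> nc p1 + nc p2 = nc p}"

definition tau :: "nat \<Rightarrow> diagram" where
  "tau k = perm_part (2 * k) (\<lambda>i. if i < k then k + i else i - k)"

definition K_set :: "diagram \<Rightarrow> diagram \<Rightarrow> diagram set" where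
  "K_set p p1 = {p2 \<in> parts (deg p).
     p1 \<circ>\<^sub>P p2 = p \<and> p1 \<otimes>\<^sub>P p2 \<le>\<^sub>P (p \<otimes>\<^sub>P ident (deg p)) \<circ>\<^sub>P tau (deg p)}"

definition prec_part :: "diagram \<Rightarrow> diagram \<Rightarrow> bool"  (infix \<open>\<prec>\<^sub>P\<close> 50) where
  "p1 \<prec>\<^sub>P p \<longleftrightarrow> p1 \<in> parts (deg p) \<and> K_set p p1 \<noteq> {}"


section \<open>Linear forms on the space of partitions up to conjugation, and their convolutions\<close>

definition conj_part :: "(nat \<Rightarrow> nat) \<Rightarrow> diagram \<Rightarrow> diagram" where
  "conj_part \<sigma> p = perm_part (deg p) \<sigma> \<circ>\<^sub>P p \<circ>\<^sub>P perm_part (deg p) (inv \<sigma>)"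

text \<open>A linear form on the direct sum of the spaces spanned by the orbits of \<open>parts k\<close> under
  conjugation is given by its values on the basis, that is, by a function on
  \<open>all_parts\<close> that is constant on the orbits. Such functions are taken to be extensional
  (\<open>undefined\<close> outside \<open>all_parts\<close>), so that equality of functions is equality of forms.\<close>

definition part_forms :: "(diagram \<Rightarrow> complex) set" where
  "part_forms = {\<phi> \<in> extensional all_parts.
     \<forall>k. \<forall>p\<in>parts k. \<forall>\<sigma>. \<sigma> permutes {..<k} \<longrightarrow> \<phi> (conj_part \<sigma> p) = \<phi> p}"

definition boxplus ::
  "(diagram \<Rightarrow> complex) \<Rightarrow> (diagram \<Rightarrow> complex) \<Rightarrow> diagram \<Rightarrow> complex"  (infixl \<open>\<boxplus>\<close> 65) where
  "\<phi>1 \<boxplus> \<phi>2 = (\<lambda>p\<in>all_parts. \<Sum>(p1, p2, I)\<in>F2 p. \<phi>1 p1 * \<phi>2 p2)"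

definition boxtimes ::
  "(diagram \<Rightarrow> complex) \<Rightarrow> (diagram \<Rightarrow> complex) \<Rightarrow> diagram \<Rightarrow> complex"  (infixl \<open>\<boxtimes>\<close> 70) where
  "\<phi>1 \<boxtimes> \<phi>2 = (\<lambda>p\<in>all_parts. \<Sum>p1 | p1 \<prec>\<^sub>P p. \<Sum>p2\<in>K_set p p1. \<phi>1 p1 * \<phi>2 p2)"


section \<open>Tracial algebras\<close>

text \<open>Algebras need not have a unit. Accordingly, sub-algebras are not required to contain one, so
  the sub-algebra generated by \<open>a\<close> consists of the polynomials in \<open>a\<close> without constant
  term; for unital algebras this makes freeness of two elements the weaker hypothesis.\<close>

locale complex_algebra = vector_space scale
  for scale :: "complex \<Rightarrow> 'a::ring \<Rightarrow> 'a" +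
  assumes scale_mult_left: "scale c x * y = scale c (x * y)"
    and scale_mult_right: "x * scale c y = scale c (x * y)"

definition multilinear_form ::
  "(complex \<Rightarrow> 'a::ring \<Rightarrow> 'a) \<Rightarrow> nat \<Rightarrow> ('a list \<Rightarrow> complex) \<Rightarrow> bool" where
  "multilinear_form scale k f \<longleftrightarrow>
    (\<forall>xs. length xs = k \<longrightarrow> (\<forall>i<k. Vector_Spaces.linear scale (*) (\<lambda>x. f (xs[i := x]))))"

definition insert_part :: "nat \<Rightarrow> nat list \<Rightarrow> diagram \<Rightarrow> diagram" where
  "insert_part l js p = relabel id (\<lambda>j. js ! j) p \<union> {{(Top, i), (Bot, i)} |i. i < l \<and> i \<notin> set js}"

text \<open>For the list \<open>ns\<close> of the lengths of the words, \<open>word_start ns j\<close> is the position of the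
  first letter of word \<open>j\<close> in their concatenation, and \<open>word_cycles ns\<close> is the product
  of the cycles that run through the successive words.\<close>

definition word_start :: "nat list \<Rightarrow> nat \<Rightarrow> nat" where
  "word_start ns j = sum_list (take j ns)"

definition word_cycles :: "nat list \<Rightarrow> nat \<Rightarrow> nat" where
  "word_cycles ns =
    foldr (\<circ>) (map (\<lambda>j. cycle_of_list [word_start ns j..<word_start ns (Suc j)]) [0..<length ns]) id"

text \<open>Only meant for non-empty words.\<close>

definition word_prod :: "'a::ring list \<Rightarrow> 'a" where
  "word_prod xs = foldl (*) (hd xs) (tl xs)"

locale P_tracial_algebra = complex_algebra scale
  for scale :: "complex \<Rightarrow> 'a::ring \<Rightarrow> 'a" +
  fixes m :: "diagram \<Rightarrow> 'a list \<Rightarrow> complex"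
  assumes multilinear: "p \<in> parts k \<Longrightarrow> multilinear_form scale k (m p)"
    and m_empty: "m {} [] = 1"
    and m_conj: "\<lbrakk>p \<in> parts k; length xs = k; \<sigma> permutes {..<k}\<rbrakk> \<Longrightarrow>
       m p xs = m (perm_part k \<sigma> \<circ>\<^sub>P p \<circ>\<^sub>P perm_part k (inv \<sigma>)) (permute_list (inv \<sigma>) xs)"
    and m_prod: "\<lbrakk>p \<in> parts k; length xss = k; [] \<notin> set xss;
         ns = map length xss; n = sum_list ns\<rbrakk> \<Longrightarrow>
       m p (map word_prod xss) =
       m (insert_part n (map (word_start ns) [0..<k]) p \<circ>\<^sub>P perm_part n (word_cycles ns)) (concat xss)"

text \<open>The case \<open>k = 0\<close> of the defining relation says \<open>\<kappa> {} [] = m {} [] = 1\<close>. The last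
  condition only fixes junk values, so that the family is unique as a total function.\<close>

definition is_cumulants ::
  "(complex \<Rightarrow> 'a::ring \<Rightarrow> 'a) \<Rightarrow> (diagram \<Rightarrow> 'a list \<Rightarrow> complex) \<Rightarrow>
   (diagram \<Rightarrow> 'a list \<Rightarrow> complex) \<Rightarrow> bool" where
  "is_cumulants scale m \<kappa> \<longleftrightarrow>
    (\<forall>k. \<forall>p\<in>parts k. multilinear_form scale k (\<kappa> p)) \<and>
    (\<forall>k. \<forall>p\<in>parts k. \<forall>xs. length xs = k \<longrightarrow> m p xs = (\<Sum>q | q \<in> parts k \<and> q \<le>\<^sub>P p. \<kappa> q xs)) \<and>
    (\<forall>p xs. p \<notin> parts (length xs) \<longrightarrow> \<kappa> p xs = 0)"

definition cumulant ::
  "(complex \<Rightarrow> 'a::ring \<Rightarrow> 'a) \<Rightarrow> (diagram \<Rightarrow> 'a list \<Rightarrow> complex) \<Rightarrow>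
   diagram \<Rightarrow> 'a list \<Rightarrow> complex" where
  "cumulant scale m = (THE \<kappa>. is_cumulants scale m \<kappa>)"

definition R_transform ::
  "(complex \<Rightarrow> 'a::ring \<Rightarrow> 'a) \<Rightarrow> (diagram \<Rightarrow> 'a list \<Rightarrow> complex) \<Rightarrow> 'a \<Rightarrow> diagram \<Rightarrow> complex" where
  "R_transform scale m a = (\<lambda>p\<in>all_parts. cumulant scale m p (replicate (deg p) a))"

definition subalgebra :: "(complex \<Rightarrow> 'a::ring \<Rightarrow> 'a) \<Rightarrow> 'a set \<Rightarrow> bool" where
  "subalgebra scale S \<longleftrightarrow> module.subspace scale S \<and> (\<forall>x\<in>S. \<forall>y\<in>S. x * y \<in> S)"

text \<open>A cycle is a union of columns, so it contains column \<open>i\<close> iff it contains \<open>(Top, i)\<close>.\<close>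

definition P_free_algebras ::
  "(complex \<Rightarrow> 'a::ring \<Rightarrow> 'a) \<Rightarrow> (diagram \<Rightarrow> 'a list \<Rightarrow> complex) \<Rightarrow> 'a set \<Rightarrow> 'a set \<Rightarrow> bool" where
  "P_free_algebras scale m A1 A2 \<longleftrightarrow>
    (\<forall>k. \<forall>p\<in>parts k. \<forall>xs (\<epsilon> :: nat \<Rightarrow> nat).
       length xs = k \<and>
       (\<forall>i<k. \<epsilon> i \<in> {1, 2} \<and> xs ! i \<in> (if \<epsilon> i = 1 then A1 else A2)) \<and>
       (\<exists>c\<in>cycles p. \<exists>i j. (Top, i) \<in> c \<and> (Top, j) \<in> c \<and> \<epsilon> i \<noteq> \<epsilon> j) \<longrightarrow>
       cumulant scale m p xs = 0) \<and>
    (\<forall>k1 k2. \<forall>p1\<in>parts k1. \<forall>p2\<in>parts k2. \<forall>xs ys.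
       length xs = k1 \<and> set xs \<subseteq> A1 \<and> length ys = k2 \<and> set ys \<subseteq> A2 \<longrightarrow>
       cumulant scale m (p1 \<otimes>\<^sub>P p2) (xs @ ys) = cumulant scale m p1 xs * cumulant scale m p2 ys)"

definition P_free ::
  "(complex \<Rightarrow> 'a::ring \<Rightarrow> 'a) \<Rightarrow> (diagram \<Rightarrow> 'a list \<Rightarrow> complex) \<Rightarrow> 'a \<Rightarrow> 'a \<Rightarrow> bool" where
  "P_free scale m a b \<longleftrightarrow>
    P_free_algebras scale m (subalgebra scale hull {a}) (subalgebra scale hull {b})"


section \<open>Existence and uniqueness of the cumulants\<close>



lemma refines_card:
  assumes fin: "finite A" and r: "refines A P Q"
  shows "card Q \<le> card P" "card Q = card P \<Longrightarrow> P = Q"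
proof -
  have P: "partition_on A P" and Q: "partition_on A Q" using r by (auto simp: refines_def)
  have finP: "finite P" using finite_elements[OF fin P] .
  define f where "f X = (SOME Y. Y \<in> Q \<and> X \<subseteq> Y)" for X
  have f: "f X \<in> Q \<and> X \<subseteq> f X" if "X \<in> P" for X
    unfolding f_def by (rule someI_ex) (use r that in \<open>auto simp: refines_def\<close>)
  have dQ: "Y = Z" if "Y \<in> Q" "Z \<in> Q" "x \<in> Y" "x \<in> Z" for x Y Z
    using Q that unfolding partition_on_def disjoint_def by blast
  have meet: "\<exists>X\<in>P. x \<in> X \<and> f X = Y" if Y: "Y \<in> Q" and x: "x \<in> Y" for x Y
  proof -
    have "x \<in> A" using Q Y x unfolding partition_on_def by blast
    then obtain X where X: "X \<in> P" "x \<in> X" using P unfolding partition_on_def by blast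
    then have "f X = Y" using f[OF X(1)] dQ[OF _ Y _ x, of "f X"] by blast
    then show ?thesis using X by blast
  qed
  have img: "f ` P = Q"
  proof
    show "f ` P \<subseteq> Q" using f by blast
    show "Q \<subseteq> f ` P"
    proof
      fix Y assume Y: "Y \<in> Q"
      then have "Y \<noteq> {}" using Q unfolding partition_on_def by blast
      then show "Y \<in> f ` P" using meet[OF Y] by blast
    qed
  qed
  then show "card Q \<le> card P" using card_image_le[OF finP, of f] by simp
  assume eq: "card Q = card P"
  then have inj: "inj_on f P" using img finP by (intro eq_card_imp_inj_on) auto
  have "f X = X" if X: "X \<in> P" for X
  proof
    show "X \<subseteq> f X" using f[OF X] by blast
    show "f X \<subseteq> X"
    proof
      fix x assume "x \<in> f X"
      then obtain X' where "X' \<in> P" "x \<in> X'" "f X' = f X" using meet f[OF X] by blast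
      then show "x \<in> X" using inj X by (auto dest: inj_onD)
    qed
  qed
  then show "P = Q" using img by (simp add: image_cong)
qed

lemma finite_parts: "finite (parts k)"
  unfolding parts_def by (rule finitely_many_partition_on) simp

lemma dist_part_pos:
  assumes "p \<in> parts k" "q \<in> parts k" "p \<noteq> q"
  shows "dist_part p q > 0"
proof -
  let ?A = "{Top, Bot} \<times> {..<k}"
  have p: "partition_on ?A p" and q: "partition_on ?A q" using assms by (auto simp: parts_def)
  note j = join_is_finest_coarser(1,2)[OF p q]
  have fin: "finite ?A" by simp
  note c1 = refines_card[OF fin j(1)] and c2 = refines_card[OF fin j(2)]
  note c1(1) c2(1)
  moreover have "\<not> (card (p \<or>\<^sub>P q) = card p \<and> card (p \<or>\<^sub>P q) = card q)"
    using c1(2) c2(2) assms(3) by metis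
  ultimately have "2 * card (p \<or>\<^sub>P q) < card p + card q" by linarith
  then show ?thesis by (simp add: dist_part_def nc_def)
qed

lemma dist_part_self:
  assumes "p \<in> parts k"
  shows "dist_part p p = 0"
proof -
  let ?A = "{Top, Bot} \<times> {..<k}"
  have p: "partition_on ?A p" using assms by (auto simp: parts_def)
  have "p \<or>\<^sub>P p = p"
    using join_is_finest_coarser(1,3)[OF p p] refines_refl[OF p] refines_asym by blast
  then show ?thesis by (simp add: dist_part_def)
qed

lemma le_part_refl: "p \<in> parts k \<Longrightarrow> p \<le>\<^sub>P p"
  by (simp add: le_part_def dist_part_self)

definition below :: "nat \<Rightarrow> diagram \<Rightarrow> diagram set" where
  "below k p = {q \<in> parts k. q \<le>\<^sub>P p \<and> q \<noteq> p}"

definition rank_part :: "nat \<Rightarrow> diagram \<Rightarrow> nat" where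
  "rank_part k p = card {q \<in> parts k. dist_part (ident k) q < dist_part (ident k) p}"

lemma rank_below:
  assumes p: "p \<in> parts k" and q: "q \<in> below k p"
  shows "rank_part k q < rank_part k p"
proof -
  have q': "q \<in> parts k" "q \<le>\<^sub>P p" "q \<noteq> p" using q by (auto simp: below_def)
  then have lt: "dist_part (ident k) q < dist_part (ident k) p"
    using dist_part_pos[OF q'(1) p q'(3)] by (simp add: le_part_def)
  show ?thesis
    unfolding rank_part_def
  proof (rule psubset_card_mono)
    show "finite {q \<in> parts k. dist_part (ident k) q < dist_part (ident k) p}"
      using finite_parts by simp
    show "{r \<in> parts k. dist_part (ident k) r < dist_part (ident k) q}
        \<subset> {q \<in> parts k. dist_part (ident k) q < dist_part (ident k) p}"
      using lt q'(1) by auto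
  qed
qed

lemma sum_le_part:
  assumes "p \<in> parts k"
  shows "(\<Sum>q | q \<in> parts k \<and> q \<le>\<^sub>P p. f q) = f p + (\<Sum>q\<in>below k p. f q :: complex)"
proof -
  have "{q. q \<in> parts k \<and> q \<le>\<^sub>P p} = insert p (below k p)"
    using assms le_part_refl[OF assms] by (auto simp: below_def)
  moreover have "finite (below k p)" "p \<notin> below k p"
    using finite_parts[of k] by (simp_all add: below_def)
  ultimately show ?thesis by simp
qed

lemma triangular_solution:
  "\<exists>f. \<forall>p\<in>parts k. rank_part k p < n \<longrightarrow>
     (g p :: 'b \<Rightarrow> complex) = (\<lambda>x. f p x + (\<Sum>q\<in>below k p. f q x))"
proof (induction n)
  case 0
  then show ?case by simp
next
  case (Suc n)
  then obtain f where f: "\<And>p. p \<in> parts k \<Longrightarrow> rank_part k p < n \<Longrightarrow>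
     g p = (\<lambda>x. f p x + (\<Sum>q\<in>below k p. f q x))" by blast
  define h where
    "h p = (if rank_part k p = n then (\<lambda>x. g p x - (\<Sum>q\<in>below k p. f q x)) else f p)" for p
  have "g p = (\<lambda>x. h p x + (\<Sum>q\<in>below k p. h q x))" if p: "p \<in> parts k" "rank_part k p < Suc n" for p
  proof -
    have "h q = f q" if "q \<in> below k p" for q
      using rank_below[OF p(1) that] p(2) by (simp add: h_def)
    then have "(\<Sum>q\<in>below k p. h q x) = (\<Sum>q\<in>below k p. f q x)" for x by (intro sum.cong) auto
    moreover have "g p x = h p x + (\<Sum>q\<in>below k p. f q x)" for x
      using f[OF p(1)] p(2) by (cases "rank_part k p = n") (auto simp: h_def)
    ultimately show ?thesis by auto
  qed
  then show ?case by blast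
qed

lemma triangular_unique:
  assumes "\<And>p. p \<in> parts k \<Longrightarrow> f p + (\<Sum>q\<in>below k p. f q) = h p + (\<Sum>q\<in>below k p. h q :: complex)"
    and "p \<in> parts k"
  shows "f p = h p"
  using assms(2)
proof (induction "rank_part k p" arbitrary: p rule: less_induct)
  case less
  have "f q = h q" if q: "q \<in> below k p" for q
    using q less.hyps[OF rank_below[OF less.prems q]] by (simp add: below_def)
  then have "(\<Sum>q\<in>below k p. f q) = (\<Sum>q\<in>below k p. h q)" by (rule sum.cong[OF refl])
  then show ?case using assms(1)[OF less.prems] by simp
qed

lemma linear_iff_vs:
  assumes "vector_space scale"
  shows "Vector_Spaces.linear scale ((*) :: complex \<Rightarrow> complex \<Rightarrow> complex) f \<longleftrightarrow>
    (\<forall>x y. f (x + y) = f x + f y) \<and> (\<forall>c x. f (scale c x) = c * f x)"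
proof -
  have "vector_space ((*) :: complex \<Rightarrow> complex \<Rightarrow> complex)"
    by unfold_locales (simp_all add: algebra_simps)
  then show ?thesis
    using assms by (simp add: Vector_Spaces.linear_def module_hom_iff module_iff_vector_space)
qed

theorem ex1_cumulants:
  assumes "P_tracial_algebra scale m"
  shows "\<exists>!\<kappa>. is_cumulants scale m \<kappa>"
proof (rule ex_ex1I)
  interpret P_tracial_algebra scale m by (rule assms)
  have vs: "vector_space scale" by unfold_locales
  have "\<forall>k. \<exists>f. \<forall>p\<in>parts k. m p = (\<lambda>xs. f p xs + (\<Sum>q\<in>below k p. f q xs))"
  proof
    fix k
    obtain n where n: "\<forall>p\<in>parts k. rank_part k p < n"
      using finite_nat_set_iff_bounded[of "rank_part k ` parts k"] finite_parts by auto
    then show "\<exists>f. \<forall>p\<in>parts k. m p = (\<lambda>xs. f p xs + (\<Sum>q\<in>below k p. f q xs))"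
      using triangular_solution[of k n m] by simp
  qed
  then obtain F where F: "\<And>k p. p \<in> parts k \<Longrightarrow> m p = (\<lambda>xs. F k p xs + (\<Sum>q\<in>below k p. F k q xs))"
    by metis
  define \<kappa> where "\<kappa> p xs = (if p \<in> parts (length xs) then F (length xs) p xs else 0)" for p xs
  have rel: "m p xs = \<kappa> p xs + (\<Sum>q\<in>below k p. \<kappa> q xs)" if "p \<in> parts k" "length xs = k" for p k xs
  proof -
    have "(\<Sum>q\<in>below k p. F k q xs) = (\<Sum>q\<in>below k p. \<kappa> q xs)"
      using that by (intro sum.cong) (auto simp: \<kappa>_def below_def)
    then show ?thesis using that by (simp add: \<kappa>_def F)
  qed
  have supp: "\<kappa> p xs = 0" if "p \<notin> parts (length xs)" for p xs
    using that by (simp add: \<kappa>_def)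
  have lin: "multilinear_form scale k (\<kappa> p)" if "p \<in> parts k" for p k
    using that
  proof (induction "rank_part k p" arbitrary: p rule: less_induct)
    case less
    show ?case
      unfolding multilinear_form_def
    proof (intro allI impI)
      fix xs :: "'a list" and i
      assume xs: "length xs = k" and i: "i < k"
      let ?L = "\<lambda>f. Vector_Spaces.linear scale (*) (\<lambda>x. f (xs[i := x]) :: complex)"
      have Lm: "?L (m p)"
        using multilinear[OF less.prems] xs i by (auto simp: multilinear_form_def)
      have Lq: "?L (\<kappa> q)" if "q \<in> below k p" for q
        using less.hyps[OF rank_below[OF less.prems that]] that xs i
        by (auto simp: multilinear_form_def below_def)
      have eq: "\<kappa> p (xs[i := x]) = m p (xs[i := x]) - (\<Sum>q\<in>below k p. \<kappa> q (xs[i := x]))" for x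
        using rel[OF less.prems, of "xs[i := x]"] xs by simp
      show "?L (\<kappa> p)"
        unfolding eq linear_iff_vs[OF vs]
        using Lm Lq unfolding linear_iff_vs[OF vs]
        by (simp add: sum.distrib sum_distrib_left algebra_simps)
    qed
  qed
  have "is_cumulants scale m \<kappa>"
    unfolding is_cumulants_def using lin rel supp by (simp add: sum_le_part)
  then show "\<exists>\<kappa>. is_cumulants scale m \<kappa>" by blast
next
  fix \<kappa> \<kappa>' assume "is_cumulants scale m \<kappa>" "is_cumulants scale m \<kappa>'"
  then have \<kappa>: "\<And>k p xs. p \<in> parts k \<Longrightarrow> length xs = k \<Longrightarrow> m p xs = \<kappa> p xs + (\<Sum>q\<in>below k p. \<kappa> q xs)"
      "\<And>k p xs. p \<in> parts k \<Longrightarrow> length xs = k \<Longrightarrow> m p xs = \<kappa>' p xs + (\<Sum>q\<in>below k p. \<kappa>' q xs)"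
      "\<And>p xs. p \<notin> parts (length xs) \<Longrightarrow> \<kappa> p xs = 0"
      "\<And>p xs. p \<notin> parts (length xs) \<Longrightarrow> \<kappa>' p xs = 0"
    unfolding is_cumulants_def by (simp_all add: sum_le_part)
  have "\<kappa> p xs = \<kappa>' p xs" for p xs
  proof (cases "p \<in> parts (length xs)")
    case True
    show ?thesis
    proof (rule triangular_unique[OF _ True, of "\<lambda>q. \<kappa> q xs" "\<lambda>q. \<kappa>' q xs"])
      fix q assume "q \<in> parts (length xs)"
      then show "\<kappa> q xs + (\<Sum>r\<in>below (length xs) q. \<kappa> r xs)
          = \<kappa>' q xs + (\<Sum>r\<in>below (length xs) q. \<kappa>' r xs)"
        using \<kappa>(1,2)[of q "length xs" xs] by simp
    qed
  qed (simp add: \<kappa>(3,4))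
  then show "\<kappa> = \<kappa>'" by blast
qed

corollary cumulant_is_cumulants:
  assumes "P_tracial_algebra scale m"
  shows "is_cumulants scale m (cumulant scale m)"
  unfolding cumulant_def by (rule theI'[OF ex1_cumulants[OF assms]])


section \<open>The R-transform is constant on conjugation orbits\<close>


lemma components_eqI:
  assumes C: "partition_on (\<Union>F) C"
    and up: "\<And>B. B \<in> F \<Longrightarrow> \<exists>Y\<in>C. B \<subseteq> Y"
    and low: "\<And>Y. Y \<in> C \<Longrightarrow> \<exists>D\<in>components F. Y \<subseteq> D"
  shows "components F = C"
proof (rule refines_asym)
  show "refines (\<Union>F) (components F) C"
    unfolding refines_def using partition_on_components C components_least[OF C up] by blast
  show "refines (\<Union>F) C (components F)"
    unfolding refines_def using partition_on_components C low by blast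
qed

lemma partition_on_map_image:
  assumes "inj_on f A" "partition_on A P"
  shows "partition_on (f ` A) ((`) f ` P)"
proof -
  have "{} \<notin> (`) f ` P" using assms(2) unfolding partition_on_def by auto
  then show ?thesis using partition_on_inj_image[OF assms(2,1)] by simp
qed

lemma components_image:
  assumes inj: "inj_on f (\<Union>F)" and ne: "{} \<notin> F"
  shows "components ((`) f ` F) = (`) f ` components F"
proof (rule components_eqI)
  have U: "\<Union>((`) f ` F) = f ` \<Union>F" by blast
  show "partition_on (\<Union>((`) f ` F)) ((`) f ` components F)"
    unfolding U using partition_on_map_image[OF inj partition_on_components] .
  show "\<exists>Y\<in>(`) f ` components F. B \<subseteq> Y" if Bi: "B \<in> (`) f ` F" for B
  proof -
    obtain B' where B': "B' \<in> F" "B = f ` B'" using Bi by auto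
    then have "B' \<noteq> {}" using ne by auto
    then obtain C where "C \<in> components F" "B' \<subseteq> C" using components_upper[OF B'(1)] by auto
    then show ?thesis using B'(2) by (intro bexI[of _ "f ` C"]) auto
  qed
  show "\<exists>D\<in>components ((`) f ` F). Y \<subseteq> D" if Yi: "Y \<in> (`) f ` components F" for Y
  proof -
    let ?S = "(\<lambda>D. f -` D \<inter> \<Union>F) ` components ((`) f ` F) - {{}}"
    have P: "partition_on (f ` \<Union>F) (components ((`) f ` F))"
      using partition_on_components[of "(`) f ` F"] unfolding U .
    have S: "partition_on (\<Union>F) ?S"
    proof (rule partition_onI)
      show "\<Union>?S = \<Union>F" using P unfolding partition_on_def by blast
      show "disjnt p q" if "p \<in> ?S" "q \<in> ?S" "p \<noteq> q" for p q
      proof -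
        obtain D D' where D: "D \<in> components ((`) f ` F)" "p = f -` D \<inter> \<Union>F"
            "D' \<in> components ((`) f ` F)" "q = f -` D' \<inter> \<Union>F"
          using \<open>p \<in> ?S\<close> \<open>q \<in> ?S\<close> by blast
        then have "D \<noteq> D'" using \<open>p \<noteq> q\<close> by blast
        then have "D \<inter> D' = {}" using P D(1,3) by (auto simp: partition_on_def disjoint_def)
        then show ?thesis unfolding disjnt_def D(2,4) by blast
      qed
      show "{} \<notin> ?S" by blast
    qed
    obtain C where C: "C \<in> components F" "Y = f ` C" using Yi by blast
    have "\<exists>Z\<in>?S. B \<subseteq> Z" if B: "B \<in> F" for B
    proof -
      have "B \<noteq> {}" using ne B by auto
      then obtain D where "D \<in> components ((`) f ` F)" "f ` B \<subseteq> D"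
        using components_upper[of "f ` B" "(`) f ` F"] B by blast
      then show ?thesis using B \<open>B \<noteq> {}\<close> by (intro bexI[of _ "f -` D \<inter> \<Union>F"]) auto
    qed
    then obtain Z where "Z \<in> ?S" "C \<subseteq> Z" using components_least[OF S _ C(1)] by blast
    then show ?thesis using C(2) by blast
  qed
qed

lemma components_attach:
  assumes F: "partition_on A F" and X: "X \<subseteq> A" and h: "inj_on h X" "h ` X \<inter> A = {}"
  shows "components (F \<union> (\<lambda>x. {x, h x}) ` X) = (\<lambda>B. B \<union> h ` (B \<inter> X)) ` F" (is "components ?G = ?C")
proof (rule components_eqI)
  have UF: "\<Union>F = A" and ne: "{} \<notin> F" and disj: "\<And>B B'. B \<in> F \<Longrightarrow> B' \<in> F \<Longrightarrow> B \<noteq> B' \<Longrightarrow> B \<inter> B' = {}"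
    using F unfolding partition_on_def disjoint_def by blast+
  have U: "\<Union>?G = A \<union> h ` X" using UF X by auto
  show "partition_on (\<Union>?G) ?C"
    unfolding U
  proof (rule partition_onI)
    show "\<Union>?C = A \<union> h ` X" using UF X by blast
    show "{} \<notin> ?C" using ne by auto
    show "disjnt p q" if pq: "p \<in> ?C" "q \<in> ?C" "p \<noteq> q" for p q
    proof -
      obtain B B' where B: "B \<in> F" "p = B \<union> h ` (B \<inter> X)" "B' \<in> F" "q = B' \<union> h ` (B' \<inter> X)"
        using pq(1,2) by auto
      then have d: "B \<inter> B' = {}" using disj pq(3) by blast
      have "h ` (B \<inter> X) \<inter> h ` (B' \<inter> X) = {}" using h(1) d by (auto dest: inj_onD)
      moreover have "h ` (B \<inter> X) \<inter> B' = {}" "B \<inter> h ` (B' \<inter> X) = {}" using h(2) B UF by blast+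
      ultimately show ?thesis unfolding disjnt_def B using d by blast
    qed
  qed
  show "\<exists>Y\<in>?C. B \<subseteq> Y" if Bi: "B \<in> ?G" for B
  proof (cases "B \<in> F")
    case False
    then obtain x where x: "x \<in> X" "B = {x, h x}" using Bi by blast
    then obtain B' where "B' \<in> F" "x \<in> B'" using X UF by blast
    then show ?thesis using x by (intro bexI[of _ "B' \<union> h ` (B' \<inter> X)"]) auto
  next
    case True
    then show ?thesis by (intro bexI[of _ "B \<union> h ` (B \<inter> X)"]) auto
  qed
  show "\<exists>D\<in>components ?G. Y \<subseteq> D" if Yi: "Y \<in> ?C" for Y
  proof -
    obtain B where B: "B \<in> F" "Y = B \<union> h ` (B \<inter> X)" using Yi by blast
    then have "B \<noteq> {}" using ne by auto
    then obtain D where D: "D \<in> components ?G" "B \<subseteq> D" using components_upper[of B ?G] B(1) by auto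
    have "h x \<in> D" if x: "x \<in> B \<inter> X" for x
    proof -
      obtain D' where D': "D' \<in> components ?G" "{x, h x} \<subseteq> D'"
        using components_upper[of "{x, h x}" ?G] x by auto
      have "D' = D"
      proof (rule ccontr)
        assume "D' \<noteq> D"
        then have "D' \<inter> D = {}"
          using partition_on_components[of ?G] D(1) D'(1) by (auto simp: partition_on_def disjoint_def)
        then show False using D(2) D'(2) x by blast
      qed
      then show ?thesis using D' by blast
    qed
    then have "Y \<subseteq> D" using D(2) B(2) by auto
    then show ?thesis using D(1) by blast
  qed
qed

lemma partition_on_relabel:
  assumes "partition_on A p" "inj_on (map_prod f g) A"
  shows "partition_on (map_prod f g ` A) (relabel f g p)"
  unfolding relabel_def by (rule partition_on_map_image[OF assms(2,1)])

lemma perm_part_image: "perm_part k \<sigma> = (\<lambda>i. {(Top, i), (Bot, \<sigma> i)}) ` {..<k}"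
  by (auto simp: perm_part_def)

lemma Mid_image: "f ` ({Mid} \<times> {..<k}) = (\<lambda>i. f (Mid, i)) ` {..<k}"
  by auto

lemma perm_comp_part:
  assumes p: "p \<in> parts k" and s: "\<sigma> permutes {..<k}"
  shows "perm_part k \<sigma> \<circ>\<^sub>P p = (\<lambda>B. (\<lambda>(r, i). (r, if r = Bot then \<sigma> i else i)) ` B) ` p"
proof -
  let ?f = "\<lambda>r. if r = Bot then Mid else r" and ?g = "\<lambda>r. if r = Top then Mid else r"
  let ?h = "\<lambda>(r :: row, i). (Bot, \<sigma> i)" and ?X = "{Mid} \<times> {..<k}" and ?A = "{Top, Mid} \<times> {..<k}"
  let ?b = "\<lambda>(r, i). (r, if r = Bot then \<sigma> i else i)"
  have p': "partition_on ({Top, Bot} \<times> {..<k}) p" using p by (simp add: parts_def)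
  have sub: "B \<subseteq> {Top, Bot} \<times> {..<k}" if "B \<in> p" for B
    using p' that unfolding partition_on_def by blast
  have ne: "{} \<notin> p" using p' unfolding partition_on_def by blast
  have "map_prod ?f id ` ({Top, Bot} \<times> {..<k}) = ?A" by (force simp: map_prod_def image_iff)
  moreover have "inj_on (map_prod ?f id) ({Top, Bot} \<times> {..<k})" by (auto simp: inj_on_def)
  ultimately have q: "partition_on ?A (relabel ?f id p)"
    using partition_on_relabel[OF p', of ?f id] by simp
  have g: "relabel ?g id (perm_part k \<sigma>) = (\<lambda>x. {x, ?h x}) ` ?X"
    unfolding relabel_def perm_part_image Mid_image by (simp add: image_image)
  have "components (relabel ?f id p \<union> (\<lambda>x. {x, ?h x}) ` ?X)
      = (\<lambda>B. B \<union> ?h ` (B \<inter> ?X)) ` relabel ?f id p"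
  proof (rule components_attach[OF q])
    show "inj_on ?h ?X" using permutes_inj[OF s] by (auto simp: inj_on_def)
  qed auto
  then have eq: "perm_part k \<sigma> \<circ>\<^sub>P p = (\<lambda>B. (\<lambda>B. (B \<union> ?h ` (B \<inter> ?X)) \<inter> {Top, Bot} \<times> UNIV) (map_prod ?f id ` B)) ` p - {{}}"
    unfolding comp_part_def g unfolding relabel_def by (simp add: image_image)
  have "(map_prod ?f id ` B \<union> ?h ` (map_prod ?f id ` B \<inter> ?X)) \<inter> {Top, Bot} \<times> UNIV = ?b ` B"
    (is "?L = _") if "B \<in> p" for B
  proof
    show "?L \<subseteq> ?b ` B"
    proof
      fix y assume y: "y \<in> ?L"
      have im: "?b (r, i) \<in> ?b ` B" if "(r, i) \<in> B" for r i using that by (rule imageI)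
      have "\<exists>r i. (r, i) \<in> B \<and> y = ?b (r, i)"
      proof -
        from y consider r i where "(r, i) \<in> B" "y = (?f r, i)" "?f r \<noteq> Mid"
          | r i where "(r, i) \<in> B" "?f r = Mid" "y = ?h (Mid, i)"
          by auto
        then show ?thesis
          using sub[OF that] by cases (fastforce split: if_splits)+
      qed
      then show "y \<in> ?b ` B" using im by blast
    qed
    show "?b ` B \<subseteq> ?L"
    proof
      fix y assume "y \<in> ?b ` B"
      then obtain r i where ri: "(r, i) \<in> B" "y = ?b (r, i)" by auto
      then have r: "r = Top \<or> r = Bot" "i < k" using sub[OF that] by auto
      then show "y \<in> ?L"
      proof (cases "r = Bot")
        case True
        then have "(Mid, i) \<in> map_prod ?f id ` B \<inter> ?X" using ri r by force
        then have "?h (Mid, i) \<in> ?h ` (map_prod ?f id ` B \<inter> ?X)" by (rule imageI)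
        then show ?thesis using ri True by simp
      next
        case False
        then have "(Top, i) \<in> map_prod ?f id ` B" using ri r by force
        then show ?thesis using ri r False by simp
      qed
    qed
  qed
  then have "perm_part k \<sigma> \<circ>\<^sub>P p = (\<lambda>B. ?b ` B) ` p - {{}}"
    unfolding eq by (simp cong: image_cong)
  moreover have "{} \<notin> (\<lambda>B. ?b ` B) ` p" using ne by auto
  ultimately show ?thesis by simp
qed

lemma part_comp_perm:
  assumes p: "p \<in> parts k" and s: "\<sigma> permutes {..<k}"
  shows "p \<circ>\<^sub>P perm_part k (inv \<sigma>) = (\<lambda>B. (\<lambda>(r, i). (r, if r = Top then \<sigma> i else i)) ` B) ` p"
proof -
  let ?f = "\<lambda>r. if r = Top then Mid else r" and ?g = "\<lambda>r. if r = Bot then Mid else r"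
  let ?h = "\<lambda>(r :: row, i). (Top, \<sigma> i)" and ?X = "{Mid} \<times> {..<k}" and ?A = "{Mid, Bot} \<times> {..<k}"
  let ?b = "\<lambda>(r, i). (r, if r = Top then \<sigma> i else i)"
  have p': "partition_on ({Top, Bot} \<times> {..<k}) p" using p by (simp add: parts_def)
  have sub: "B \<subseteq> {Top, Bot} \<times> {..<k}" if "B \<in> p" for B
    using p' that unfolding partition_on_def by blast
  have ne: "{} \<notin> p" using p' unfolding partition_on_def by blast
  have "map_prod ?f id ` ({Top, Bot} \<times> {..<k}) = ?A" by (force simp: map_prod_def image_iff)
  moreover have "inj_on (map_prod ?f id) ({Top, Bot} \<times> {..<k})" by (auto simp: inj_on_def)
  ultimately have q: "partition_on ?A (relabel ?f id p)"
    using partition_on_relabel[OF p', of ?f id] by simp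
  have "perm_part k (inv \<sigma>) = (\<lambda>i. {(Top, \<sigma> i), (Bot, i)}) ` {..<k}"
  proof
    show "perm_part k (inv \<sigma>) \<subseteq> (\<lambda>i. {(Top, \<sigma> i), (Bot, i)}) ` {..<k}"
    proof
      fix B assume "B \<in> perm_part k (inv \<sigma>)"
      then obtain i where i: "i < k" "B = {(Top, i), (Bot, inv \<sigma> i)}" unfolding perm_part_def by blast
      moreover have "inv \<sigma> i < k" using permutes_in_image[OF permutes_inv[OF s], of i] i by simp
      moreover have "\<sigma> (inv \<sigma> i) = i" using permutes_inverses[OF s] by simp
      ultimately show "B \<in> (\<lambda>i. {(Top, \<sigma> i), (Bot, i)}) ` {..<k}"
        by (intro image_eqI[of _ _ "inv \<sigma> i"]) auto
    qed
    show "(\<lambda>i. {(Top, \<sigma> i), (Bot, i)}) ` {..<k} \<subseteq> perm_part k (inv \<sigma>)"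
    proof (rule image_subsetI)
      fix i assume "i \<in> {..<k}"
      then have "\<sigma> i < k" "inv \<sigma> (\<sigma> i) = i"
        using permutes_in_image[OF s, of i] permutes_inverses[OF s] by auto
      then show "{(Top, \<sigma> i), (Bot, i)} \<in> perm_part k (inv \<sigma>)" unfolding perm_part_def
        by (intro CollectI exI[of _ "\<sigma> i"]) simp
    qed
  qed
  then have g: "relabel ?g id (perm_part k (inv \<sigma>)) = (\<lambda>x. {x, ?h x}) ` ?X"
    unfolding relabel_def Mid_image by (simp add: image_image insert_commute)
  have "components (relabel ?f id p \<union> (\<lambda>x. {x, ?h x}) ` ?X)
      = (\<lambda>B. B \<union> ?h ` (B \<inter> ?X)) ` relabel ?f id p"
  proof (rule components_attach[OF q])
    show "inj_on ?h ?X" using permutes_inj[OF s] by (auto simp: inj_on_def)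
  qed auto
  then have eq: "p \<circ>\<^sub>P perm_part k (inv \<sigma>) = (\<lambda>B. (\<lambda>B. (B \<union> ?h ` (B \<inter> ?X)) \<inter> {Top, Bot} \<times> UNIV) (map_prod ?f id ` B)) ` p - {{}}"
    unfolding comp_part_def g Un_commute[of "(\<lambda>x. {x, ?h x}) ` ?X"]
    unfolding relabel_def by (simp add: image_image)
  have "(map_prod ?f id ` B \<union> ?h ` (map_prod ?f id ` B \<inter> ?X)) \<inter> {Top, Bot} \<times> UNIV = ?b ` B"
    (is "?L = _") if "B \<in> p" for B
  proof
    show "?L \<subseteq> ?b ` B"
    proof
      fix y assume y: "y \<in> ?L"
      have im: "?b (r, i) \<in> ?b ` B" if "(r, i) \<in> B" for r i using that by (rule imageI)
      have "\<exists>r i. (r, i) \<in> B \<and> y = ?b (r, i)"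
      proof -
        from y consider r i where "(r, i) \<in> B" "y = (?f r, i)" "?f r \<noteq> Mid"
          | r i where "(r, i) \<in> B" "?f r = Mid" "y = ?h (Mid, i)"
          by auto
        then show ?thesis
          using sub[OF that] by cases (fastforce split: if_splits)+
      qed
      then show "y \<in> ?b ` B" using im by blast
    qed
    show "?b ` B \<subseteq> ?L"
    proof
      fix y assume "y \<in> ?b ` B"
      then obtain r i where ri: "(r, i) \<in> B" "y = ?b (r, i)" by auto
      then have r: "r = Top \<or> r = Bot" "i < k" using sub[OF that] by auto
      then show "y \<in> ?L"
      proof (cases "r = Top")
        case True
        then have "(Mid, i) \<in> map_prod ?f id ` B \<inter> ?X" using ri r by force
        then have "?h (Mid, i) \<in> ?h ` (map_prod ?f id ` B \<inter> ?X)" by (rule imageI)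
        then show ?thesis using ri True by simp
      next
        case False
        then have "(Bot, i) \<in> map_prod ?f id ` B" using ri r by force
        then show ?thesis using ri r False by simp
      qed
    qed
  qed
  then have "p \<circ>\<^sub>P perm_part k (inv \<sigma>) = (\<lambda>B. ?b ` B) ` p - {{}}"
    unfolding eq by (simp cong: image_cong)
  moreover have "{} \<notin> (\<lambda>B. ?b ` B) ` p" using ne by auto
  ultimately show ?thesis by simp
qed

context
  fixes k :: nat and \<sigma> :: "nat \<Rightarrow> nat"
  assumes s: "\<sigma> permutes {..<k}"
begin

lemma inj_map_prod_perm: "inj (map_prod id \<sigma> :: point \<Rightarrow> point)"
  using permutes_inj[OF s] by (simp add: prod.inj_map)

lemma relabel_perm_parts: "p \<in> parts k \<Longrightarrow> relabel id \<sigma> p \<in> parts k"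
proof -
  assume "p \<in> parts k"
  then have "partition_on (map_prod id \<sigma> ` ({Top, Bot} \<times> {..<k})) (relabel id \<sigma> p)"
    using inj_map_prod_perm by (intro partition_on_relabel) (auto simp: parts_def inj_on_def)
  moreover have "map_prod id \<sigma> ` ({Top, Bot} \<times> {..<k}) = {Top, Bot} \<times> {..<k}"
    using permutes_image[OF s] by (simp add: map_prod_surj_on[OF refl refl])
  ultimately show ?thesis by (simp add: parts_def)
qed

lemma conj_part_eq_relabel:
  assumes p: "p \<in> parts k"
  shows "conj_part \<sigma> p = relabel id \<sigma> p"
proof -
  let ?b = "\<lambda>(r, i). (r, if r = Bot then \<sigma> i else i)"
  let ?t = "\<lambda>(r, i). (r, if r = Top then \<sigma> i else i)"
  have p': "partition_on ({Top, Bot} \<times> {..<k}) p" using p by (simp add: parts_def)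
  have sub: "B \<subseteq> {Top, Bot} \<times> {..<k}" if "B \<in> p" for B
    using p' that unfolding partition_on_def by blast
  have "inj_on ?b ({Top, Bot} \<times> {..<k})"
    using permutes_inj[OF s] by (auto simp: inj_on_def split: if_splits)
  then have "partition_on (?b ` ({Top, Bot} \<times> {..<k})) ((`) ?b ` p)"
    by (rule partition_on_map_image[OF _ p'])
  moreover have "?b ` ({Top, Bot} \<times> {..<k}) = {Top, Bot} \<times> {..<k}"
  proof -
    have "?b ` ({Top, Bot} \<times> {..<k}) = ({Top} \<times> {..<k}) \<union> ({Bot} \<times> \<sigma> ` {..<k})"
      by (auto simp: image_iff)
    then show ?thesis using permutes_image[OF s] by auto
  qed
  ultimately have b: "(`) ?b ` p \<in> parts k" by (simp add: parts_def)
  have "conj_part \<sigma> p = (`) ?t ` ((`) ?b ` p)"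
    unfolding conj_part_def deg_parts[OF p] perm_comp_part[OF p s] part_comp_perm[OF b s] ..
  also have "\<dots> = (\<lambda>B. (\<lambda>x. ?t (?b x)) ` B) ` p" by (simp add: image_image)
  also have "\<dots> = relabel id \<sigma> p"
    unfolding relabel_def
  proof (rule image_cong[OF refl], rule image_cong[OF refl])
    fix B x assume "B \<in> p" "x \<in> B"
    then show "?t (?b x) = map_prod id \<sigma> x" using sub by fastforce
  qed
  finally show ?thesis .
qed

lemma nc_relabel: "nc (relabel id \<sigma> p) = nc p"
  unfolding nc_def relabel_def
  by (intro card_image) (use inj_map_prod_perm in \<open>auto simp: inj_on_def inj_image_eq_iff\<close>)

lemma join_relabel:
  assumes "p \<in> parts k" "q \<in> parts k"
  shows "relabel id \<sigma> p \<or>\<^sub>P relabel id \<sigma> q = relabel id \<sigma> (p \<or>\<^sub>P q)"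
proof -
  have "{} \<notin> p \<union> q" using assms unfolding parts_def partition_on_def by blast
  then show ?thesis
    using components_image[OF inj_on_subset[OF inj_map_prod_perm], of "p \<union> q"]
    by (simp add: join_def relabel_def image_Un)
qed

lemma relabel_ident: "relabel id \<sigma> (ident k) = ident k"
proof -
  have "relabel id \<sigma> (ident k) = (\<lambda>i. {(Top, i), (Bot, i)}) ` \<sigma> ` {..<k}"
    unfolding relabel_def ident_def perm_part_image by (simp add: image_image)
  also have "\<dots> = ident k"
    unfolding permutes_image[OF s] by (simp add: ident_def perm_part_image)
  finally show ?thesis .
qed

end

lemma ident_parts: "ident k \<in> parts k"
proof -
  have "partition_on ({Top, Bot} \<times> {..<k}) (ident k)"
  proof (rule partition_onI)
    show "\<Union>(ident k) = {Top, Bot} \<times> {..<k}" by (auto simp: ident_def perm_part_def)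
    show "disjnt p q" if "p \<in> ident k" "q \<in> ident k" "p \<noteq> q" for p q
      using that by (auto simp: ident_def perm_part_def disjnt_def)
    show "{} \<notin> ident k" by (auto simp: ident_def perm_part_def)
  qed
  then show ?thesis by (simp add: parts_def)
qed

lemma le_part_relabel:
  assumes s: "\<sigma> permutes {..<k}" and p: "p \<in> parts k" and q: "q \<in> parts k"
  shows "relabel id \<sigma> p \<le>\<^sub>P relabel id \<sigma> q \<longleftrightarrow> p \<le>\<^sub>P q"
proof -
  have d: "dist_part (relabel id \<sigma> p) (relabel id \<sigma> q) = dist_part p q"
    if "p \<in> parts k" "q \<in> parts k" for p q
    unfolding dist_part_def join_relabel[OF s that] by (simp add: nc_relabel[OF s])
  show ?thesis
    using d[OF p q] d[OF ident_parts p] d[OF ident_parts q] p relabel_perm_parts[OF s p]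
    by (simp add: le_part_def relabel_ident[OF s])
qed

theorem R_transform_in_part_forms:
  assumes "P_tracial_algebra scale m"
  shows "R_transform scale m a \<in> part_forms"
proof -
  interpret P_tracial_algebra scale m by (rule assms)
  let ?\<kappa> = "cumulant scale m"
  have *: "?\<kappa> (relabel id \<sigma> p) (replicate k a) = ?\<kappa> p (replicate k a)"
    if s: "\<sigma> permutes {..<k}" and p: "p \<in> parts k" for k \<sigma> p
  proof (rule triangular_unique[OF _ p, of "\<lambda>p. ?\<kappa> (relabel id \<sigma> p) (replicate k a)"])
    fix p assume p: "p \<in> parts k"
    let ?xs = "replicate k a"
    have rel: "m p ?xs = ?\<kappa> p ?xs + (\<Sum>q\<in>below k p. ?\<kappa> q ?xs)" if "p \<in> parts k" for p
      using cumulant_is_cumulants[OF assms] that unfolding is_cumulants_def by (simp add: sum_le_part)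
    have r: "relabel id \<sigma> q \<in> parts k" if "q \<in> parts k" for q
      using relabel_perm_parts[OF s that] .
    have inj: "inj_on (relabel id \<sigma>) (parts k)"
    proof (rule inj_onI)
      fix x y assume "relabel id \<sigma> x = relabel id \<sigma> y"
      then show "x = y"
        unfolding relabel_def using inj_map_prod_perm[OF s]
        by (simp add: inj_image_eq_iff inj_def)
    qed
    have surj: "relabel id \<sigma> ` parts k = parts k"
      using r by (intro endo_inj_surj[OF finite_parts _ inj]) blast
    have img: "relabel id \<sigma> ` below k p = below k (relabel id \<sigma> p)"
    proof
      show "relabel id \<sigma> ` below k p \<subseteq> below k (relabel id \<sigma> p)"
        using r p le_part_relabel[OF s] inj by (auto simp: below_def dest: inj_onD)
      show "below k (relabel id \<sigma> p) \<subseteq> relabel id \<sigma> ` below k p"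
      proof
        fix q assume q: "q \<in> below k (relabel id \<sigma> p)"
        then have "q \<in> relabel id \<sigma> ` parts k" unfolding surj by (simp add: below_def)
        then obtain q' where "q' \<in> parts k" "q = relabel id \<sigma> q'" by blast
        then show "q \<in> relabel id \<sigma> ` below k p"
          using q le_part_relabel[OF s _ p] by (auto simp: below_def)
      qed
    qed
    have "permute_list (inv \<sigma>) ?xs = ?xs"
    proof (rule nth_equalityI)
      fix i assume "i < length (permute_list (inv \<sigma>) ?xs)"
      then show "permute_list (inv \<sigma>) ?xs ! i = ?xs ! i"
        using permutes_in_image[OF permutes_inv[OF s], of i] by (simp add: permute_list_def)
    qed simp
    then have "m (relabel id \<sigma> p) ?xs = m p ?xs"
      using m_conj[OF p _ s, of ?xs] conj_part_eq_relabel[OF s p] p by (simp add: conj_part_def)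
    then have "?\<kappa> (relabel id \<sigma> p) ?xs + (\<Sum>q\<in>below k (relabel id \<sigma> p). ?\<kappa> q ?xs)
        = ?\<kappa> p ?xs + (\<Sum>q\<in>below k p. ?\<kappa> q ?xs)"
      using rel[OF p] rel[OF r[OF p]] by simp
    moreover have "(\<Sum>q\<in>below k (relabel id \<sigma> p). ?\<kappa> q ?xs) = (\<Sum>q\<in>below k p. ?\<kappa> (relabel id \<sigma> q) ?xs)"
      unfolding img[symmetric]
      by (rule sum.reindex[unfolded o_def]) (rule inj_on_subset[OF inj], auto simp: below_def)
    ultimately show "?\<kappa> (relabel id \<sigma> p) ?xs + (\<Sum>q\<in>below k p. ?\<kappa> (relabel id \<sigma> q) ?xs)
        = ?\<kappa> p ?xs + (\<Sum>q\<in>below k p. ?\<kappa> q ?xs)" by simp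
  qed
  have "R_transform scale m a (conj_part \<sigma> p) = R_transform scale m a p"
    if "p \<in> parts k" "\<sigma> permutes {..<k}" for k \<sigma> p
    using *[OF that(2,1)] relabel_perm_parts[OF that(2,1)] that
    by (auto simp: R_transform_def conj_part_eq_relabel[OF that(2,1)] all_parts_def)
  moreover have "R_transform scale m a \<in> extensional all_parts"
    by (simp add: R_transform_def)
  ultimately show ?thesis by (auto simp: part_forms_def)
qed

end

theory Submission
  imports Defs
begin

text \<open>
  Why the theorem holds. Freeness says that a cumulant \<open>\<kappa>\<^sub>p\<close> evaluated at a word in \<open>a\<close> and \<open>b\<close>
  vanishes if some block of \<open>p\<close> meets both columns that carry \<open>a\<close> and columns that carry \<open>b\<close>;
  otherwise, sorting the columns turns \<open>p\<close> into a tensor product and the cumulant into a product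
  (\<open>cumulant_word\<close>). Sorting is allowed because cumulants, like moments, are
  invariant under simultaneous relabelling of the diagram and the arguments
  (\<open>cumulant_relabel\<close>).

  For the sum, expand \<open>\<kappa>\<^sub>p (a + b, \<dots>, a + b)\<close> over the sets \<open>I\<close> of columns that
  receive \<open>a\<close>. The surviving \<open>I\<close> are those that index \<open>F2 p\<close>, since the number of blocks is
  additive under extraction exactly if no block is cut (\<open>nc_extractions_iff_splits\<close>).

  For the product it is enough to compare moments, since the relation between moments and
  cumulants is triangular. The trace property gives
  \<open>m\<^sub>p (ab, \<dots>, ab) = m\<^sub>q (a, \<dots>, a, b, \<dots>, b)\<close>, where
  \<open>q = (p \<otimes> id) \<circ> \<tau>\<close> is called \<open>twist k p\<close> below, and by freeness the right-hand side is the sum of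
  \<open>\<R>[a](p\<^sub>1) \<R>[b](p\<^sub>2)\<close> over all \<open>p\<^sub>1 \<otimes> p\<^sub>2 \<le> twist k p\<close>. The combinatorial core is
  \<open>tensor_le_twist_iff\<close>:
  \<open>p\<^sub>1 \<otimes> p\<^sub>2 \<le> twist k p\<close> holds iff \<open>r = p\<^sub>1 \<circ> p\<^sub>2\<close> satisfies \<open>r \<le> p\<close> and
  \<open>p\<^sub>1 \<otimes> p\<^sub>2 \<le> twist k r\<close>. Grouping the sum by \<open>r\<close> turns it into the sum over \<open>r \<le> p\<close> of
  \<open>(\<R>[a] \<boxtimes> \<R>[b])(r)\<close>.

  The core is proved by counting. Written with numbers of connected components, \<open>p \<le> q\<close> is the case
  of equality in a triangle inequality. Let \<open>S\<close> be the three-row diagram of the composition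
  \<open>p\<^sub>1 \<circ> p\<^sub>2\<close>. Contracting the pairs \<open>{i, (k + i)'}\<close> of \<open>twist k p\<close> identifies the components of
  \<open>p\<^sub>1 \<otimes> p\<^sub>2\<close> joined with \<open>twist k p\<close> with those of \<open>S \<union> p\<close>, and contracting the columns identifies
  the components of \<open>twist k p\<close> joined with the identity with the cycles of \<open>p\<close>. With these counts, the equality that
  expresses \<open>p\<^sub>1 \<otimes> p\<^sub>2 \<le> twist k p\<close> is the sum of those that express \<open>r \<le> p\<close> and
  \<open>p\<^sub>1 \<otimes> p\<^sub>2 \<le> twist k r\<close>. Each of the latter two is an inequality in general, so their sum is an
  equality iff both are.
\<close>

section \<open>Counting connected components\<close>

definition saturated :: "'b set set \<Rightarrow> 'b set set" where
  "saturated F = {X. X \<subseteq> \<Union>F \<and> (\<forall>B\<in>F. B \<subseteq> X \<or> B \<inter> X = {})}"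

lemma saturated_Un:
  assumes "\<Union>F = \<Union>G"
  shows "saturated (F \<union> G) = saturated F \<inter> saturated G"
  using assms unfolding saturated_def by auto

lemma finite_saturated: "finite (\<Union>F) \<Longrightarrow> finite (saturated F)"
  by (rule finite_subset[of _ "Pow (\<Union>F)"]) (auto simp: saturated_def)

lemma saturated_cong: "X \<in> saturated F \<Longrightarrow> B \<in> F \<Longrightarrow> x \<in> B \<Longrightarrow> y \<in> B \<Longrightarrow> x \<in> X \<longleftrightarrow> y \<in> X"
  by (auto simp: saturated_def)

lemma component_eqI:
  assumes "C \<in> components F" "D \<in> components F" "x \<in> C" "x \<in> D"
  shows "C = D"
proof (rule ccontr)
  assume "C \<noteq> D"
  moreover have "disjoint (components F)"
    using partition_on_components[of F] by (simp only: partition_on_def)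
  ultimately have "C \<inter> D = {}" using assms(1,2) by (metis disjointD)
  then show False using assms(3,4) by blast
qed

lemma Union_components: "\<Union>(components F) = \<Union>F"
  using partition_on_components[of F] by (simp only: partition_on_def)

lemma component_nonempty: "C \<in> components F \<Longrightarrow> C \<noteq> {}"
  using partition_on_components[of F] by (metis partition_on_def)

lemma component_subset: "C \<in> components F \<Longrightarrow> C \<subseteq> \<Union>F"
  using Union_components[of F] by (metis Union_upper)

lemma component_saturated_cases:
  assumes X: "X \<in> saturated F" and C: "C \<in> components F"
  shows "C \<subseteq> X \<or> C \<inter> X = {}"
proof -
  have "C \<noteq> {}" "C \<subseteq> \<Union>F"
    by (rule component_nonempty[OF C], rule component_subset[OF C])
  have "X \<subseteq> \<Union>F" using X by (simp add: saturated_def)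
  have part: "partition_on (\<Union>F) ({X, \<Union>F - X} - {{}})"
  proof (rule partition_onI)
    show "\<Union>({X, \<Union>F - X} - {{}}) = \<Union>F"
      using \<open>X \<subseteq> \<Union>F\<close> by (cases "X = {}"; cases "\<Union>F - X = {}") auto
    show "disjnt p q" if "p \<in> {X, \<Union>F - X} - {{}}" "q \<in> {X, \<Union>F - X} - {{}}" "p \<noteq> q" for p q
      using that unfolding disjnt_def by blast
  qed simp
  have up: "\<exists>Y\<in>{X, \<Union>F - X} - {{}}. B \<subseteq> Y" if B: "B \<in> F" for B
  proof -
    consider "B = {}" "X = {}" | "B = {}" "X \<noteq> {}" | "B \<noteq> {}" "B \<subseteq> X" | "B \<noteq> {}" "B \<inter> X = {}"
      using X B unfolding saturated_def by blast
    then show ?thesis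
    proof cases
      case 1
      then have "\<Union>F - X \<noteq> {}" using \<open>C \<noteq> {}\<close> \<open>C \<subseteq> \<Union>F\<close> by blast
      then show ?thesis using 1 by simp
    next
      case 4
      then have "B \<subseteq> \<Union>F - X" using B by blast
      then show ?thesis using 4(1) by blast
    qed blast+
  qed
  obtain Y where "Y \<in> {X, \<Union>F - X} - {{}}" "C \<subseteq> Y"
    using components_least[of "\<Union>F" "{X, \<Union>F - X} - {{}}" F C, OF part _ C] up by metis
  then have "C \<subseteq> X \<or> C \<subseteq> \<Union>F - X" by simp metis
  then show ?thesis by blast
qed

lemma Union_components_saturated:
  assumes D: "D \<subseteq> components F"
  shows "\<Union>D \<in> saturated F"
  unfolding saturated_def
proof (intro CollectI conjI ballI)
  note P = partition_on_components[of F]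
  show "\<Union>D \<subseteq> \<Union>F" using D P unfolding partition_on_def by blast
  fix B assume B: "B \<in> F"
  show "B \<subseteq> \<Union>D \<or> B \<inter> \<Union>D = {}"
  proof (cases "B = {}")
    case False
    then obtain C where C: "C \<in> components F" "B \<subseteq> C" using components_upper[OF B] by blast
    have "C \<inter> C' = {}" if "C' \<in> D" "C \<notin> D" for C'
      using component_eqI[of C F C'] C(1) D that by blast
    then show ?thesis using C by blast
  qed simp
qed

lemma saturated_eq_Unions: "saturated F = Union ` Pow (components F)"
proof
  show "Union ` Pow (components F) \<subseteq> saturated F"
    using Union_components_saturated by blast
  show "saturated F \<subseteq> Union ` Pow (components F)"
  proof
    fix X assume X: "X \<in> saturated F"
    have "X = \<Union>{C \<in> components F. C \<subseteq> X}"
    proof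
      show "X \<subseteq> \<Union>{C \<in> components F. C \<subseteq> X}"
      proof
        fix x assume x: "x \<in> X"
        then have "x \<in> \<Union>F" using X by (auto simp: saturated_def)
        then obtain C where "C \<in> components F" "x \<in> C"
          using partition_on_components[of F] unfolding partition_on_def by blast
        then show "x \<in> \<Union>{C \<in> components F. C \<subseteq> X}"
          using component_saturated_cases[OF X] x by blast
      qed
    qed blast
    then show "X \<in> Union ` Pow (components F)" by blast
  qed
qed

text \<open>A saturated set is a choice of connected components. The saturated sets form a vector space
  over the field with two elements, with symmetric difference as addition, and the number of
  components is its dimension. In this form, equalities between numbers of components follow
  from bijections between saturated sets, and inequalities from fibre counts.\<close>

lemma card_saturated:
  assumes "finite (\<Union>F)"
  shows "card (saturated F) = 2 ^ card (components F)"
proof -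
  have P: "partition_on (\<Union>F) (components F)" by (rule partition_on_components)
  have sub: "D \<subseteq> E" if DE: "D \<subseteq> components F" "E \<subseteq> components F" "\<Union>D = \<Union>E" for D E
  proof
    fix C assume C: "C \<in> D"
    then have CF: "C \<in> components F" using DE(1) by blast
    then obtain x where x: "x \<in> C" using component_nonempty by blast
    then obtain C' where C': "C' \<in> E" "x \<in> C'" using C DE(3) by blast
    then have "C' = C" using component_eqI[OF _ CF _ x, of C'] DE(2) by blast
    then show "C \<in> E" using C' by simp
  qed
  have "inj_on Union (Pow (components F))"
    by (rule inj_onI) (metis sub PowD subset_antisym)
  then show ?thesis
    unfolding saturated_eq_Unions using finite_elements[OF assms P]
    by (simp add: card_image card_Pow)
qed

lemma card_components_eqI:
  assumes "finite (\<Union>F)" "finite (\<Union>G)" "bij_betw f (saturated F) (saturated G)"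
  shows "card (components F) = card (components G)"
  using bij_betw_same_card[OF assms(3)] by (simp add: card_saturated assms)

lemma card_components_cong:
  assumes "finite (\<Union>F)" "\<Union>F = \<Union>G" "saturated F = saturated G"
  shows "card (components F) = card (components G)"
  using card_components_eqI[of F G id] assms by simp

text \<open>Points with the same image under \<open>g\<close> are connected already, because each \<open>x\<close> is connected to
  \<open>h (g x)\<close>. The second hypothesis says this in terms of saturated sets, which spares the
  construction of paths.\<close>

lemma card_components_contract:
  assumes fin: "finite (\<Union>F)"
    and h: "\<And>x X. x \<in> \<Union>F \<Longrightarrow> X \<in> saturated F \<Longrightarrow> h (g x) \<in> X \<longleftrightarrow> x \<in> X"
  shows "card (components ((`) g ` F)) = card (components F)"
proof -
  have U: "\<Union>((`) g ` F) = g ` \<Union>F" by blast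
  have eq: "x \<in> X \<longleftrightarrow> y \<in> X" if "x \<in> \<Union>F" "y \<in> \<Union>F" "g x = g y" "X \<in> saturated F" for x y X
    using h[of x X] h[of y X] that by simp
  have "bij_betw (\<lambda>X. g ` X) (saturated F) (saturated ((`) g ` F))"
  proof (rule bij_betw_byWitness[where f' = "\<lambda>Y. g -` Y \<inter> \<Union>F"])
    show "\<forall>X\<in>saturated F. g -` (g ` X) \<inter> \<Union>F = X"
    proof
      fix X assume X: "X \<in> saturated F"
      then have "X \<subseteq> \<Union>F" by (auto simp: saturated_def)
      then show "g -` (g ` X) \<inter> \<Union>F = X" using eq[OF _ _ _ X] by blast
    qed
    show "\<forall>Y\<in>saturated ((`) g ` F). g ` (g -` Y \<inter> \<Union>F) = Y"
      unfolding saturated_def U by blast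
    show "(`) g ` saturated F \<subseteq> saturated ((`) g ` F)"
    proof (rule image_subsetI)
      fix X assume X: "X \<in> saturated F"
      then have "X \<subseteq> \<Union>F" by (auto simp: saturated_def)
      moreover have "g ` B \<subseteq> g ` X \<or> g ` B \<inter> g ` X = {}" if "B \<in> F" for B
      proof (cases "B \<subseteq> X")
        case False
        then have "B \<inter> X = {}" using X that by (auto simp: saturated_def)
        then have "g ` B \<inter> g ` X = {}" using eq[OF _ _ _ X] \<open>X \<subseteq> \<Union>F\<close> that by blast
        then show ?thesis by simp
      qed blast
      ultimately show "g ` X \<in> saturated ((`) g ` F)"
        unfolding saturated_def U by auto
    qed
    show "(\<lambda>Y. g -` Y \<inter> \<Union>F) ` saturated ((`) g ` F) \<subseteq> saturated F"
    proof (rule image_subsetI)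
      fix Y assume Y: "Y \<in> saturated ((`) g ` F)"
      then have "g ` B \<subseteq> Y \<or> g ` B \<inter> Y = {}" if "B \<in> F" for B
        using that by (auto simp: saturated_def)
      then show "g -` Y \<inter> \<Union>F \<in> saturated F"
        unfolding saturated_def by blast
    qed
  qed
  moreover have "finite (\<Union>((`) g ` F))" unfolding U using fin by simp
  ultimately show ?thesis using card_components_eqI[OF fin] by metis
qed

lemma components_partition:
  assumes "partition_on A p"
  shows "components p = p"
proof (rule components_eqI)
  have U: "\<Union>p = A" using assms by (simp add: partition_on_def)
  show "partition_on (\<Union>p) p" using assms by (simp add: U)
  show "\<exists>D\<in>components p. Y \<subseteq> D" if "Y \<in> p" for Y
  proof -
    have "Y \<noteq> {}" using assms that unfolding partition_on_def by blast
    then show ?thesis using components_upper[OF that] by blast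
  qed
qed blast

text \<open>If \<open>X\<close> is saturated for \<open>F\<close> and \<open>P\<close>, and \<open>Y\<close> for \<open>P\<close> and \<open>Q\<close>, then the symmetric
  difference of \<open>X\<close> and \<open>Y\<close> is saturated for \<open>P\<close>. If two such pairs have the same symmetric
  difference, then their first components differ by a set that is saturated for \<open>F\<close> and \<open>Q\<close>. This is
  the dimension formula for a sum of two subspaces. For partitions it is the triangle
  inequality of \<open>dist_part\<close>.\<close>

lemma card_components_triangle:
  assumes fin: "finite A" and U: "\<Union>F = A" "\<Union>P = A" "\<Union>Q = A"
  shows "card (components (F \<union> P)) + card (components (P \<union> Q))
       \<le> card (components P) + card (components (F \<union> Q))"
proof -
  let ?S = "saturated F \<inter> saturated P" and ?T = "saturated P \<inter> saturated Q"
  let ?R = "saturated F \<inter> saturated Q"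
  define d :: "'a set \<Rightarrow> 'a set \<Rightarrow> 'a set" where "d X Y = (X - Y) \<union> (Y - X)" for X Y
  define fib where "fib Z = {(X, Y). X \<in> ?S \<and> Y \<in> ?T \<and> d X Y = Z}" for Z
  have dsat: "d X Y \<in> saturated G" if "X \<in> saturated G" "Y \<in> saturated G" for X Y G
    using that unfolding saturated_def d_def by blast
  have finS: "finite ?S" "finite ?T" "finite ?R" "finite (saturated P)"
    using finite_saturated[of P] finite_saturated[of Q] fin U by simp_all
  have fibre: "card (fib Z) \<le> card ?R" for Z
  proof (cases "fib Z = {}")
    case True
    then show ?thesis by simp
  next
    case False
    then obtain X0 Y0 where 0: "X0 \<in> ?S" "Y0 \<in> ?T" "d X0 Y0 = Z" by (auto simp: fib_def)
    have same: "d X X0 = d Y Y0" if "d X Y = Z" for X Y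
      using that 0(3) unfolding d_def by blast
    show ?thesis
    proof (rule card_inj_on_le[of "\<lambda>(X, Y). d X X0"])
      have c1: "X = X'" if "d X X0 = d X' X0" for X X' using that unfolding d_def by blast
      have c2: "Y = Y'" if "d X Y = d X Y'" for X Y Y' using that unfolding d_def by blast
      show "inj_on (\<lambda>(X, Y). d X X0) (fib Z)"
      proof (rule inj_onI, clarify)
        fix X Y X' Y' assume f: "(X, Y) \<in> fib Z" "(X', Y') \<in> fib Z" and e: "d X X0 = d X' X0"
        have "X = X'" by (rule c1[OF e])
        then show "X = X' \<and> Y = Y'" using f c2[of X Y Y'] by (simp add: fib_def)
      qed
      show "(\<lambda>(X, Y). d X X0) ` fib Z \<subseteq> ?R"
      proof (rule image_subsetI, clarify)
        fix X Y assume "(X, Y) \<in> fib Z"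
        then have X: "X \<in> saturated F" "Y \<in> saturated Q" and Z: "d X Y = Z" by (auto simp: fib_def)
        have "d X X0 \<in> saturated F" using dsat X(1) 0(1) by blast
        moreover have "d Y Y0 \<in> saturated Q" using dsat X(2) 0(2) by blast
        ultimately show "d X X0 \<in> ?R" using same[OF Z] by simp
      qed
    qed (use finS in simp)
  qed
  have "?S \<times> ?T = (\<Union>Z\<in>saturated P. fib Z)" unfolding fib_def using dsat by blast
  then have "card (?S \<times> ?T) \<le> (\<Sum>Z\<in>saturated P. card (fib Z))"
    using card_UN_le[OF finS(4), of fib] by (simp only:)
  also have "\<dots> \<le> card (saturated P) * card ?R"
    using sum_bounded_above[of "saturated P" "\<lambda>Z. card (fib Z)" "card ?R", OF fibre] by (simp only: of_nat_id)
  finally have "card ?S * card ?T \<le> card (saturated P) * card ?R"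
    by (simp only: card_cartesian_product)
  moreover have "?S = saturated (F \<union> P)" "?T = saturated (P \<union> Q)" "?R = saturated (F \<union> Q)"
    by (rule saturated_Un[symmetric], simp only: U)+
  moreover have "card (saturated (F \<union> P)) = 2 ^ card (components (F \<union> P))"
      "card (saturated (P \<union> Q)) = 2 ^ card (components (P \<union> Q))"
      "card (saturated (F \<union> Q)) = 2 ^ card (components (F \<union> Q))"
      "card (saturated P) = 2 ^ card (components P)"
    by (rule card_saturated, unfold Union_Un_distrib U, simp add: fin)+
  ultimately have "(2 :: nat) ^ (card (components (F \<union> P)) + card (components (P \<union> Q)))
      \<le> 2 ^ (card (components P) + card (components (F \<union> Q)))"
    unfolding power_add by argo
  then show ?thesis by simp
qed

text \<open>For the three-row diagram of a composition and its outer rows \<open>V\<close>, this is the composed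
  diagram.\<close>

definition trace_on :: "'b set \<Rightarrow> 'b set set \<Rightarrow> 'b set set" where
  "trace_on V F = (\<lambda>C. C \<inter> V) ` components F - {{}}"

lemma partition_on_trace:
  assumes "V \<subseteq> \<Union>F"
  shows "partition_on V (trace_on V F)"
proof (rule partition_onI)
  have "\<Union>(trace_on V F) = \<Union>(components F) \<inter> V" unfolding trace_on_def by auto
  then show "\<Union>(trace_on V F) = V" unfolding Union_components using assms by blast
  fix B B' assume B: "B \<in> trace_on V F" "B' \<in> trace_on V F" "B \<noteq> B'"
  then obtain C C' where "C \<in> components F" "C' \<in> components F" "B = C \<inter> V" "B' = C' \<inter> V"
    unfolding trace_on_def by blast
  moreover then have "C \<noteq> C'" using B(3) by metis
  ultimately show "disjnt B B'" using component_eqI[of C F C'] unfolding disjnt_def by auto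
qed (simp add: trace_on_def)

text \<open>Adding blocks within \<open>V\<close> merges components of \<open>F\<close> in the same way as it merges their
  traces, because the components of \<open>F\<close> that miss \<open>V\<close> stay untouched. A set that is saturated for
  \<open>F \<union> p\<close> consists of its trace on \<open>V\<close> and an arbitrary choice of such components; \<open>g\<close> puts the two
  together again.\<close>

lemma card_components_trace:
  assumes fin: "finite (\<Union>F)" and V: "V \<subseteq> \<Union>F" and p: "\<Union>p \<subseteq> V"
  shows "card (components (F \<union> p)) + card (trace_on V F)
       = card (components (trace_on V F \<union> p)) + card (components F)"
proof -
  define Out where "Out = {C \<in> components F. C \<inter> V = {}}"
  define Inn where "Inn = {C \<in> components F. C \<inter> V \<noteq> {}}"
  define g where "g Y D = \<Union>{C \<in> Inn. C \<inter> V \<subseteq> Y} \<union> \<Union>D" for Y D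
  note disj = component_eqI[of _ F]
  have cover: "\<exists>C\<in>components F. x \<in> C" if "x \<in> \<Union>F" for x
    using that Union_components[of F] by blast
  have split: "components F = Out \<union> Inn" "Out \<inter> Inn = {}"
    unfolding Out_def Inn_def by blast+
  have OutV: "C \<inter> V = {}" if "C \<in> Out" for C using that by (simp add: Out_def)
  have InnI: "C \<in> Inn" if "C \<in> components F" "x \<in> C" "x \<in> V" for C x
    using that by (auto simp: Inn_def)
  have finC: "finite (components F)" using finite_elements[OF fin partition_on_components] .
  have UT: "\<Union>(trace_on V F) = V" using partition_on_trace[OF V] by (simp only: partition_on_def)
  have UFp: "\<Union>(F \<union> p) = \<Union>F" using V p by auto
  have UTp: "\<Union>(trace_on V F \<union> p) = V" using UT p by auto
  have satFp: "X \<in> saturated (F \<union> p) \<longleftrightarrow> X \<in> saturated F \<and> (\<forall>B\<in>p. B \<subseteq> X \<or> B \<inter> X = {})" for X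
    unfolding saturated_def UFp by blast
  have T: "trace_on V F = (\<lambda>C. C \<inter> V) ` Inn" unfolding trace_on_def Inn_def by blast
  have satT: "Y \<in> saturated (trace_on V F \<union> p) \<longleftrightarrow> Y \<subseteq> V \<and> (\<forall>C\<in>Inn. C \<inter> V \<subseteq> Y \<or> C \<inter> V \<inter> Y = {})
     \<and> (\<forall>B\<in>p. B \<subseteq> Y \<or> B \<inter> Y = {})" for Y
    unfolding saturated_def UTp unfolding T by (simp add: ball_Un)
  have mem_g: "x \<in> g Y D \<longleftrightarrow> x \<in> Y" if D: "D \<subseteq> Out" and Y: "Y \<in> saturated (trace_on V F \<union> p)" and x: "x \<in> V" for x Y D
  proof -
    obtain C where C: "C \<in> components F" "x \<in> C" using x V cover by blast
    then have CI: "C \<in> Inn" using InnI x by blast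
    have "x \<in> g Y D \<longleftrightarrow> C \<inter> V \<subseteq> Y"
    proof
      assume "x \<in> g Y D"
      then obtain C' where C': "C' \<in> Inn \<and> C' \<inter> V \<subseteq> Y \<or> C' \<in> D" "x \<in> C'" by (auto simp: g_def)
      then have "C' \<in> Inn" "C' \<inter> V \<subseteq> Y" using D OutV x by blast+
      moreover have "C' = C" using disj[OF _ C(1) C'(2) C(2)] \<open>C' \<in> Inn\<close> by (simp add: Inn_def)
      ultimately show "C \<inter> V \<subseteq> Y" by simp
    qed (use C CI in \<open>auto simp: g_def\<close>)
    moreover have "C \<inter> V \<subseteq> Y \<or> C \<inter> V \<inter> Y = {}" using Y CI by (simp add: satT)
    ultimately show ?thesis using C(2) x by blast
  qed
  have "bij_betw (\<lambda>X. (X \<inter> V, {C \<in> Out. C \<subseteq> X})) (saturated (F \<union> p))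
      (saturated (trace_on V F \<union> p) \<times> Pow Out)"
  proof (rule bij_betw_byWitness[where f' = "\<lambda>(Y, D). g Y D"])
    show "\<forall>X\<in>saturated (F \<union> p). (case (X \<inter> V, {C \<in> Out. C \<subseteq> X}) of (Y, D) \<Rightarrow> g Y D) = X"
    proof (intro ballI, simp)
      fix X assume "X \<in> saturated (F \<union> p)"
      then have X: "X \<in> saturated F" by (simp add: satFp)
      have c: "C \<subseteq> X \<or> C \<inter> X = {}" if "C \<in> components F" for C
        using component_saturated_cases[OF X that] .
      show "g (X \<inter> V) {C \<in> Out. C \<subseteq> X} = X"
      proof (rule set_eqI, rule iffI)
        fix x assume "x \<in> g (X \<inter> V) {C \<in> Out. C \<subseteq> X}"
        then consider C where "C \<in> Inn" "C \<inter> V \<subseteq> X \<inter> V" "x \<in> C" | "x \<in> X"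
          by (auto simp: g_def)
        then show "x \<in> X"
        proof cases
          case 1
          then show ?thesis using c[of C] by (auto simp: Inn_def)
        qed
      next
        fix x assume x: "x \<in> X"
        then have "x \<in> \<Union>F" using X by (auto simp: saturated_def)
        then obtain C where C: "C \<in> components F" "x \<in> C" using cover by blast
        then have "C \<subseteq> X" using c x by blast
        then show "x \<in> g (X \<inter> V) {C \<in> Out. C \<subseteq> X}"
          using C by (cases "C \<inter> V = {}") (auto simp: g_def Inn_def Out_def)
      qed
    qed
    show "\<forall>z\<in>saturated (trace_on V F \<union> p) \<times> Pow Out.
       ((case z of (Y, D) \<Rightarrow> g Y D) \<inter> V, {C \<in> Out. C \<subseteq> (case z of (Y, D) \<Rightarrow> g Y D)}) = z"
    proof (clarify, rule conjI)
      fix Y D assume Y: "Y \<in> saturated (trace_on V F \<union> p)" and D: "D \<subseteq> Out"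
      have "Y \<subseteq> V" using Y by (simp add: satT)
      then show "g Y D \<inter> V = Y" using mem_g[OF D Y] by blast
      show "{C \<in> Out. C \<subseteq> g Y D} = D"
      proof
        show "{C \<in> Out. C \<subseteq> g Y D} \<subseteq> D"
        proof clarify
          fix C assume C: "C \<in> Out" "C \<subseteq> g Y D"
          then have CF: "C \<in> components F" by (simp add: Out_def)
          then obtain x where x: "x \<in> C" using component_nonempty by blast
          then have "x \<in> g Y D" using C by blast
          then obtain C' where C': "x \<in> C'" "C' \<in> Inn \<or> C' \<in> D" by (auto simp: g_def)
          then have "C' \<in> components F" using D split by blast
          then have "C' = C" using disj[OF _ CF C'(1) x] by blast
          then show "C \<in> D" using C'(2) C(1) split(2) by blast
        qed
        show "D \<subseteq> {C \<in> Out. C \<subseteq> g Y D}" using D by (auto simp: g_def)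
      qed
    qed
    show "(\<lambda>X. (X \<inter> V, {C \<in> Out. C \<subseteq> X})) ` saturated (F \<union> p) \<subseteq> saturated (trace_on V F \<union> p) \<times> Pow Out"
    proof (rule image_subsetI, intro SigmaI)
      fix X assume X: "X \<in> saturated (F \<union> p)"
      have "C \<inter> V \<subseteq> X \<inter> V \<or> C \<inter> V \<inter> (X \<inter> V) = {}" if "C \<in> Inn" for C
        using component_saturated_cases[of X F C] X that by (auto simp: satFp Inn_def)
      moreover have "B \<subseteq> X \<inter> V \<or> B \<inter> (X \<inter> V) = {}" if "B \<in> p" for B
        using X p that by (auto simp: satFp)
      ultimately show "X \<inter> V \<in> saturated (trace_on V F \<union> p)" unfolding satT by auto
    qed blast
    show "(\<lambda>(Y, D). g Y D) ` (saturated (trace_on V F \<union> p) \<times> Pow Out) \<subseteq> saturated (F \<union> p)"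
    proof (rule image_subsetI, clarify)
      fix Y D assume Y: "Y \<in> saturated (trace_on V F \<union> p)" and D: "D \<subseteq> Out"
      have "g Y D = \<Union>({C \<in> Inn. C \<inter> V \<subseteq> Y} \<union> D)" unfolding g_def by blast
      also have "\<dots> \<in> saturated F" by (rule Union_components_saturated) (use D split(1) in blast)
      finally have s: "g Y D \<in> saturated F" .
      have "B \<subseteq> g Y D \<or> B \<inter> g Y D = {}" if B: "B \<in> p" for B
      proof -
        have "B \<subseteq> V" using B p by blast
        then have "B \<inter> g Y D = B \<inter> Y" using mem_g[OF D Y] by blast
        moreover have "B \<subseteq> Y \<or> B \<inter> Y = {}" using Y B by (simp add: satT)
        ultimately show ?thesis by blast
      qed
      then show "g Y D \<in> saturated (F \<union> p)" using s by (simp add: satFp)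
    qed
  qed
  then have "card (saturated (F \<union> p)) = card (saturated (trace_on V F \<union> p)) * card (Pow Out)"
    using bij_betw_same_card by (fastforce simp: card_cartesian_product)
  moreover have "finite (\<Union>(trace_on V F \<union> p))"
    unfolding UTp using V fin by (rule finite_subset)
  moreover have "finite (\<Union>(F \<union> p))" using UFp fin by simp
  moreover have finOI: "finite Out" "finite Inn" using finC split(1) by simp_all
  ultimately have "(2 :: nat) ^ card (components (F \<union> p)) = 2 ^ (card (components (trace_on V F \<union> p)) + card Out)"
    by (simp add: card_saturated card_Pow power_add)
  then have "card (components (F \<union> p)) = card (components (trace_on V F \<union> p)) + card Out" by simp
  moreover have "inj_on (\<lambda>C. C \<inter> V) Inn"
  proof (rule inj_onI)
    fix C C' assume C: "C \<in> Inn" "C' \<in> Inn" and e: "C \<inter> V = C' \<inter> V"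
    then obtain x where "x \<in> C" "x \<in> C'" by (auto simp: Inn_def)
    then show "C = C'" using disj C by (simp add: Inn_def)
  qed
  then have "card (trace_on V F) = card Inn" unfolding T by (simp add: card_image)
  moreover have "card (components F) = card Out + card Inn"
    using card_Un_disjoint[OF finOI split(2)] split(1) by simp
  ultimately show ?thesis by simp
qed

section \<open>Composition of diagrams and the order\<close>

lemma parts_Union: "p \<in> parts k \<Longrightarrow> \<Union>p = {Top, Bot} \<times> {..<k}"
  by (simp add: parts_def partition_on_def)

lemma parts_block_subset: "p \<in> parts k \<Longrightarrow> B \<in> p \<Longrightarrow> B \<subseteq> {Top, Bot} \<times> {..<k}"
  using parts_Union by blast

lemma parts_nonempty: "p \<in> parts k \<Longrightarrow> {} \<notin> p"
  by (simp add: parts_def partition_on_def)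

lemma components_parts: "p \<in> parts k \<Longrightarrow> components p = p"
  unfolding parts_def mem_Collect_eq by (rule components_partition)

text \<open>The terms \<open>nc (ident k)\<close> and \<open>nc q\<close> cancel in the definition of the order. What remains is the
  case of equality in \<open>parts_triangle\<close>.\<close>

lemma le_part_iff:
  assumes p: "p \<in> parts k" and q: "q \<in> parts k"
  shows "p \<le>\<^sub>P q \<longleftrightarrow> nc p + card (components (ident k \<union> q))
       = card (components (ident k \<union> p)) + card (components (p \<union> q))"
proof -
  have "(i + a) / 2 - x + ((a + b) / 2 - y) = (i + b) / 2 - z \<longleftrightarrow> a + z = x + y"
    for i a b x y z :: real
    by (auto simp: field_simps)
  then have "p \<le>\<^sub>P q \<longleftrightarrow> real (nc p + card (components (ident k \<union> q)))
      = real (card (components (ident k \<union> p)) + card (components (p \<union> q)))"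
    unfolding le_part_def dist_part_def join_def nc_def deg_parts[OF p] of_nat_add .
  then show ?thesis by (simp only: of_nat_eq_iff)
qed

lemma parts_triangle:
  assumes p: "p \<in> parts k" and q: "q \<in> parts k"
  shows "card (components (ident k \<union> p)) + card (components (p \<union> q))
    \<le> nc p + card (components (ident k \<union> q))"
  using card_components_triangle[of "{Top, Bot} \<times> {..<k}" "ident k" p q]
    parts_Union[OF p] parts_Union[OF q] parts_Union[OF ident_parts[of k]]
  by (simp add: nc_def components_parts[OF p])

text \<open>The three-row diagram from which \<open>p \<circ>\<^sub>P q\<close> is obtained by erasing the middle row.\<close>

definition stack :: "diagram \<Rightarrow> diagram \<Rightarrow> diagram" where
  "stack p q = relabel (\<lambda>r. if r = Bot then Mid else r) id q \<union>
     relabel (\<lambda>r. if r = Top then Mid else r) id p"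

lemma Union_relabel: "\<Union>(relabel f g p) = map_prod f g ` \<Union>p"
  unfolding relabel_def by blast

lemma Union_stack:
  assumes "p \<in> parts k" "q \<in> parts k"
  shows "\<Union>(stack p q) = {Top, Mid, Bot} \<times> {..<k}"
proof -
  have "(\<lambda>r. if r = Bot then Mid else r) ` {Top, Bot} = {Top, Mid}"
    "(\<lambda>r. if r = Top then Mid else r) ` {Top, Bot} = {Mid, Bot}"
    by auto
  then have "\<Union>(stack p q) = {Top, Mid} \<times> {..<k} \<union> {Mid, Bot} \<times> {..<k}"
    unfolding stack_def Union_Un_distrib Union_relabel parts_Union[OF assms(1)] parts_Union[OF assms(2)]
    by (simp add: map_prod_surj_on[OF refl refl])
  then show ?thesis by auto
qed

lemma comp_part_eq_trace:
  assumes "p \<in> parts k" "q \<in> parts k"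
  shows "p \<circ>\<^sub>P q = trace_on ({Top, Bot} \<times> {..<k}) (stack p q)"
proof -
  have "C \<inter> {Top, Bot} \<times> UNIV = C \<inter> {Top, Bot} \<times> {..<k}" if "C \<in> components (stack p q)" for C
    using component_subset[OF that] unfolding Union_stack[OF assms] by auto
  then show ?thesis
    unfolding comp_part_def trace_on_def stack_def[symmetric] by (simp cong: image_cong)
qed

lemma comp_part_parts:
  assumes "p \<in> parts k" "q \<in> parts k"
  shows "p \<circ>\<^sub>P q \<in> parts k"
  unfolding parts_def comp_part_eq_trace[OF assms]
  by (intro CollectI partition_on_trace) (auto simp: Union_stack[OF assms])

lemma card_components_stack:
  assumes p1: "p1 \<in> parts k" and p2: "p2 \<in> parts k" and p: "p \<in> parts k"
  shows "card (components (stack p1 p2 \<union> p)) + nc (p1 \<circ>\<^sub>P p2)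
    = card (components ((p1 \<circ>\<^sub>P p2) \<union> p)) + card (components (stack p1 p2))"
  unfolding nc_def comp_part_eq_trace[OF p1 p2]
  by (rule card_components_trace) (auto simp: Union_stack[OF p1 p2] parts_Union[OF p])

lemma relabel_shift_partition:
  assumes "p \<in> parts k"
  shows "partition_on ({Top, Bot} \<times> {l..<l + k}) (relabel id (\<lambda>i. l + i) p)"
proof -
  have "partition_on (map_prod id (\<lambda>i. l + i) ` ({Top, Bot} \<times> {..<k})) (relabel id (\<lambda>i. l + i) p)"
    using assms by (intro partition_on_relabel) (auto simp: parts_def inj_on_def)
  moreover have "(\<lambda>i. l + i) ` {..<k} = {l..<l + k}"
    by (simp add: lessThan_atLeast0 add.commute)
  then have "map_prod id (\<lambda>i. l + i) ` ({Top, Bot} \<times> {..<k}) = {Top, Bot} \<times> {l..<l + k}"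
    by (intro map_prod_surj_on) simp_all
  ultimately show ?thesis by simp
qed

lemma
  assumes p: "p \<in> parts k" and q: "q \<in> parts l"
  shows tensor_parts: "p \<otimes>\<^sub>P q \<in> parts (k + l)"
    and nc_tensor: "nc (p \<otimes>\<^sub>P q) = nc p + nc q"
proof -
  let ?q = "relabel id (\<lambda>i. k + i) q"
  have pq: "p \<otimes>\<^sub>P q = p \<union> ?q" using p by (simp add: tensor_def)
  have P: "partition_on ({Top, Bot} \<times> {..<k}) p" using p by (simp add: parts_def)
  note Q = relabel_shift_partition[OF q, of k]
  have d: "({Top, Bot} \<times> {..<k}) \<inter> ({Top, Bot} \<times> {k..<k + l}) = ({} :: point set)" by auto
  have cross: "disjnt B B'" if "B \<in> p" "B' \<in> ?q" for B B'
  proof -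
    have "B \<subseteq> {Top, Bot} \<times> {..<k}" using partition_onD1[OF P] that(1) by (simp add: Union_upper)
    moreover have "B' \<subseteq> {Top, Bot} \<times> {k..<k + l}" using partition_onD1[OF Q] that(2) by (simp add: Union_upper)
    ultimately show ?thesis using d by (metis disjnt_def disjnt_subset1 disjnt_subset2)
  qed
  have "partition_on ({Top, Bot} \<times> {..<k} \<union> {Top, Bot} \<times> {k..<k + l}) (p \<union> ?q)"
  proof (rule partition_onI)
    show "\<Union>(p \<union> ?q) = {Top, Bot} \<times> {..<k} \<union> {Top, Bot} \<times> {k..<k + l}"
      using partition_onD1[OF P] partition_onD1[OF Q] by simp
    show "disjnt B B'" if BB: "B \<in> p \<union> ?q" "B' \<in> p \<union> ?q" "B \<noteq> B'" for B B'
    proof -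
      consider "B \<in> p" "B' \<in> p" | "B \<in> ?q" "B' \<in> ?q" | "B \<in> p" "B' \<in> ?q" | "B' \<in> p" "B \<in> ?q"
        using BB(1,2) by blast
      then show ?thesis
        by cases (use BB(3) cross partition_onD2[OF P] partition_onD2[OF Q] in
          \<open>auto simp: pairwise_def disjnt_sym\<close>)
    qed
    show "{} \<notin> p \<union> ?q" using partition_onD3[OF P] partition_onD3[OF Q] by simp
  qed
  moreover have "{Top, Bot} \<times> {..<k} \<union> {Top, Bot} \<times> {k..<k + l} = {Top, Bot} \<times> {..<k + l}" by auto
  ultimately show "p \<otimes>\<^sub>P q \<in> parts (k + l)" unfolding pq parts_def by simp
  have "p \<inter> ?q = {}"
  proof (rule ccontr)
    assume "p \<inter> ?q \<noteq> {}"
    then obtain B where B: "B \<in> p" "B \<in> ?q" by blast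
    then have "B \<subseteq> {Top, Bot} \<times> {..<k}" "B \<subseteq> {Top, Bot} \<times> {k..<k + l}" "B \<noteq> {}"
      using P Q unfolding partition_on_def by (blast, blast, metis)
    then show False using d by blast
  qed
  moreover have "finite p" "finite ?q"
    using finite_elements[OF _ P] finite_elements[OF _ Q] by auto
  moreover have "card ?q = card q"
    unfolding relabel_def
    by (intro card_image inj_onI) (auto simp: inj_image_eq_iff prod.inj_map)
  ultimately show "nc (p \<otimes>\<^sub>P q) = nc p + nc q"
    unfolding pq nc_def by (simp add: card_Un_disjoint)
qed

text \<open>The upper bound in the definition of \<open>K_set\<close>. By \<open>twist_eq\<close> below it consists of a copy of \<open>p\<close>, with
  its top row moved to the right half, and of pairs that link the left half of the top row to
  the right half of the bottom row. Joining with \<open>p1 \<otimes>\<^sub>P p2\<close>, these pairs glue the top row of \<open>p1\<close>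
  to the bottom row of \<open>p2\<close>, which is what composition does.\<close>

definition twist :: "nat \<Rightarrow> diagram \<Rightarrow> diagram" where
  "twist k p = (p \<otimes>\<^sub>P ident k) \<circ>\<^sub>P tau k"

lemma tau_permutes:
  fixes k :: nat
  shows "(\<lambda>i. if i < k then k + i else if i < 2 * k then i - k else i) permutes {..<2 * k}"
  by (rule inj_imp_permutes) (auto simp: inj_on_def)

lemma perm_part_parts:
  assumes s: "\<sigma> permutes {..<k}"
  shows "perm_part k \<sigma> \<in> parts k"
proof -
  have "\<Union>(perm_part k \<sigma>) = {Top} \<times> {..<k} \<union> {Bot} \<times> \<sigma> ` {..<k}"
    unfolding perm_part_image by auto
  also have "\<dots> = {Top, Bot} \<times> {..<k}" using permutes_image[OF s] by auto
  finally have U: "\<Union>(perm_part k \<sigma>) = {Top, Bot} \<times> {..<k}" .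
  have "disjnt B B'" if "B \<in> perm_part k \<sigma>" "B' \<in> perm_part k \<sigma>" "B \<noteq> B'" for B B'
    using that permutes_inj[OF s] by (auto simp: perm_part_def disjnt_def dest: injD)
  moreover have "{} \<notin> perm_part k \<sigma>" by (auto simp: perm_part_def)
  ultimately show ?thesis unfolding parts_def using U by (intro CollectI partition_onI)
qed

lemma tau_eq: "tau k = perm_part (2 * k) (\<lambda>i. if i < k then k + i else if i < 2 * k then i - k else i)"
  unfolding tau_def perm_part_image by (rule image_cong) auto

lemma twist_eq_image:
  assumes p: "p \<in> parts k"
  shows "twist k p = (`) (\<lambda>(r, i). (r, if r = Top then
      (if i < k then k + i else if i < 2 * k then i - k else i) else i)) ` (p \<otimes>\<^sub>P ident k)"
proof -
  let ?t = "\<lambda>i. if i < k then k + i else if i < 2 * k then i - k else i"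
  have "?t \<circ> ?t = id" by (rule ext) auto
  then have inv: "inv ?t = ?t" using inv_unique_comp by blast
  have par: "p \<otimes>\<^sub>P ident k \<in> parts (2 * k)"
    using tensor_parts[OF p ident_parts[of k]] by (simp add: mult_2)
  show ?thesis
    unfolding twist_def tau_eq using part_comp_perm[OF par tau_permutes] unfolding inv .
qed

lemma twist_eq:
  assumes p: "p \<in> parts k"
  shows "twist k p = (`) (\<lambda>(r, i). (r, if r = Top then k + i else i)) ` p
     \<union> (\<lambda>i. {(Top, i), (Bot, k + i)}) ` {..<k}"
proof -
  let ?f = "\<lambda>(r, i). (r, if r = Top then (if i < k then k + i else if i < 2 * k then i - k else i) else i)"
  have "twist k p = (`) ?f ` p \<union> (`) ?f ` relabel id (\<lambda>i. k + i) (ident k)"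
    unfolding twist_eq_image[OF p] using p by (simp add: tensor_def image_Un)
  also have "(`) ?f ` p = (`) (\<lambda>(r, i). (r, if r = Top then k + i else i)) ` p"
  proof (rule image_cong[OF refl], rule image_cong[OF refl])
    fix B x assume "B \<in> p" "x \<in> B"
    then have "x \<in> {Top, Bot} \<times> {..<k}" using parts_block_subset[OF p] by blast
    then show "?f x = (case x of (r, i) \<Rightarrow> (r, if r = Top then k + i else i))" by auto
  qed
  also have "(`) ?f ` relabel id (\<lambda>i. k + i) (ident k) = (\<lambda>i. {(Top, i), (Bot, k + i)}) ` {..<k}"
    unfolding relabel_def ident_def perm_part_image image_image by (rule image_cong) auto
  finally show ?thesis .
qed

lemma tau_parts: "tau k \<in> parts (2 * k)"
  unfolding tau_eq by (rule perm_part_parts[OF tau_permutes])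

lemma tensor_parts_double: "p \<in> parts k \<Longrightarrow> q \<in> parts k \<Longrightarrow> p \<otimes>\<^sub>P q \<in> parts (2 * k)"
  using tensor_parts[of p k q k] by (simp add: mult_2)

lemma twist_parts: "p \<in> parts k \<Longrightarrow> twist k p \<in> parts (2 * k)"
  unfolding twist_def by (intro comp_part_parts tensor_parts_double ident_parts tau_parts)

lemma card_components_add_singletons:
  assumes "finite (\<Union>G)" "\<And>B. B \<in> H \<Longrightarrow> \<exists>x\<in>\<Union>G. B = {x}"
  shows "card (components (G \<union> H)) = card (components G)"
proof (rule card_components_cong)
  have U: "\<Union>H \<subseteq> \<Union>G" using assms(2) by blast
  then show UG: "\<Union>(G \<union> H) = \<Union>G" by auto
  then show "finite (\<Union>(G \<union> H))" using assms(1) by simp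
  have "B \<subseteq> X \<or> B \<inter> X = {}" if "B \<in> H" for B X using assms(2)[OF that] by auto
  then show "saturated (G \<union> H) = saturated G" unfolding saturated_def UG by blast
qed

text \<open>The pairs of \<open>twist k p\<close> and of the identity connect the points \<open>(Bot, i)\<close>, \<open>(Top, i)\<close> and
  \<open>(Bot, k + i)\<close>, \<open>(Top, k + i)\<close>. The contraction \<open>g\<close> shrinks the columns, so that column \<open>i\<close> becomes
  the bottom point and column \<open>k + i\<close> the top point of column \<open>i\<close> of \<open>p\<close>; the pairs that link the
  halves become the identity on \<open>k\<close> columns.\<close>

lemma card_components_ident_twist:
  assumes p: "p \<in> parts k"
  shows "card (components (ident (2 * k) \<union> twist k p)) = card (components (ident k \<union> p))"
proof -
  define g :: "point \<Rightarrow> point" where "g = (\<lambda>(r, i). if i < k then (Bot, i) else (Top, i - k))"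
  define h :: "point \<Rightarrow> point" where "h = (\<lambda>(r, i). if r = Top then (Top, k + i) else (r, i))"
  let ?F = "ident (2 * k) \<union> twist k p"
  let ?H = "(\<lambda>i. {(Bot, i)}) ` {..<k} \<union> (\<lambda>i. {(Top, i)}) ` {..<k}"
  have U: "\<Union>?F = {Top, Bot} \<times> {..<2 * k}"
    using parts_Union[OF ident_parts[of "2 * k"]] parts_Union[OF twist_parts[OF p]] by auto
  have "card (components ((`) g ` ?F)) = card (components ?F)"
  proof (rule card_components_contract[where h = h])
    show "finite (\<Union>?F)" unfolding U by simp
    fix x X assume x: "x \<in> \<Union>?F" and X: "X \<in> saturated ?F"
    obtain r i where ri: "x = (r, i)" "r = Top \<or> r = Bot" "i < 2 * k" using x unfolding U by auto
    have "{(Top, i), (Bot, i)} \<in> ?F" using ri by (auto simp: ident_def perm_part_image)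
    then have "(Top, i) \<in> X \<longleftrightarrow> (Bot, i) \<in> X" using saturated_cong[OF X] by blast
    then show "h (g x) \<in> X \<longleftrightarrow> x \<in> X" using ri by (auto simp: g_def h_def)
  qed
  moreover have "(`) g ` ?F = (ident k \<union> p) \<union> ?H"
  proof -
    have "(`) g ` ident (2 * k) = (\<lambda>i. g ` {(Top, i), (Bot, i)}) ` ({..<k} \<union> (\<lambda>i. k + i) ` {..<k})"
    proof -
      have "{..<2 * k} = {..<k} \<union> (\<lambda>i. k + i) ` {..<k}"
        by (simp add: lessThan_atLeast0 mult_2 ivl_disj_un)
      then show ?thesis unfolding ident_def perm_part_image by (simp add: image_image)
    qed
    also have "\<dots> = ?H"
      unfolding image_Un image_image by (intro arg_cong2[of _ _ _ _ "(\<union>)"] image_cong) (auto simp: g_def)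
    finally have 1: "(`) g ` ident (2 * k) = ?H" .
    have 2: "(`) g ` (`) (\<lambda>(r, i). (r, if r = Top then k + i else i)) ` p = p"
    proof -
      have "g ` (\<lambda>(r, i). (r, if r = Top then k + i else i)) ` B = B" if "B \<in> p" for B
      proof -
        have "g (case x of (r, i) \<Rightarrow> (r, if r = Top then k + i else i)) = x" if "x \<in> B" for x
          using parts_block_subset[OF p \<open>B \<in> p\<close>] that by (auto simp: g_def)
        then show ?thesis unfolding image_image by simp
      qed
      then show ?thesis unfolding image_image by simp
    qed
    have 3: "(`) g ` (\<lambda>i. {(Top, i), (Bot, k + i)}) ` {..<k} = ident k"
      unfolding ident_def perm_part_image image_image by (rule image_cong) (auto simp: g_def)
    show ?thesis unfolding twist_eq[OF p] image_Un 1 2 3 by blast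
  qed
  moreover have "card (components ((ident k \<union> p) \<union> ?H)) = card (components (ident k \<union> p))"
  proof (rule card_components_add_singletons)
    have "\<Union>(ident k \<union> p) = {Top, Bot} \<times> {..<k}"
      using parts_Union[OF ident_parts[of k]] parts_Union[OF p] by auto
    then show "finite (\<Union>(ident k \<union> p))" "\<And>B. B \<in> ?H \<Longrightarrow> \<exists>x\<in>\<Union>(ident k \<union> p). B = {x}" by auto
  qed
  ultimately show ?thesis by simp
qed

text \<open>The contraction \<open>g\<close> glues \<open>(Top, i)\<close> to \<open>(Bot, k + i)\<close>; the two become the point \<open>(Mid, i)\<close>.\<close>

lemma card_components_tensor_twist:
  assumes p1: "p1 \<in> parts k" and p2: "p2 \<in> parts k" and p: "p \<in> parts k"
  shows "card (components (p1 \<otimes>\<^sub>P p2 \<union> twist k p)) = card (components (stack p1 p2 \<union> p))"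
proof -
  define g :: "point \<Rightarrow> point" where "g = (\<lambda>(r, i).
    if i < k then (if r = Top then Mid else r, i) else (if r = Bot then Mid else r, i - k))"
  define h :: "point \<Rightarrow> point" where
    "h = (\<lambda>(r, i). if r = Top then (Top, k + i) else if r = Mid then (Top, i) else (r, i))"
  let ?F = "p1 \<otimes>\<^sub>P p2 \<union> twist k p"
  let ?H = "(\<lambda>i. {(Mid, i)}) ` {..<k}"
  have U: "\<Union>?F = {Top, Bot} \<times> {..<2 * k}"
    using parts_Union[OF tensor_parts_double[OF p1 p2]] parts_Union[OF twist_parts[OF p]] by auto
  have "card (components ((`) g ` ?F)) = card (components ?F)"
  proof (rule card_components_contract[where h = h])
    show "finite (\<Union>?F)" unfolding U by simp
    fix x X assume x: "x \<in> \<Union>?F" and X: "X \<in> saturated ?F"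
    obtain r i where ri: "x = (r, i)" "r = Top \<or> r = Bot" "i < 2 * k" using x unfolding U by auto
    show "h (g x) \<in> X \<longleftrightarrow> x \<in> X"
    proof (cases "r = Bot \<and> k \<le> i")
      case True
      then have "{(Top, i - k), (Bot, k + (i - k))} \<in> ?F"
        using ri unfolding twist_eq[OF p] by (intro UnI2 imageI) simp
      then have "(Top, i - k) \<in> X \<longleftrightarrow> (Bot, i) \<in> X" using saturated_cong[OF X] True by auto
      then show ?thesis using True ri by (simp add: g_def h_def)
    next
      case False
      then show ?thesis using ri by (auto simp: g_def h_def)
    qed
  qed
  moreover have "(`) g ` ?F = (stack p1 p2 \<union> p) \<union> ?H"
  proof -
    have 1: "(`) g ` p1 = relabel (\<lambda>r. if r = Top then Mid else r) id p1"
      unfolding relabel_def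
    proof (rule image_cong[OF refl], rule image_cong[OF refl])
      fix B x assume "B \<in> p1" "x \<in> B"
      then show "g x = map_prod (\<lambda>r. if r = Top then Mid else r) id x"
        using parts_block_subset[OF p1] by (fastforce simp: g_def)
    qed
    have 2: "(`) g ` relabel id (\<lambda>i. k + i) p2 = relabel (\<lambda>r. if r = Bot then Mid else r) id p2"
      unfolding relabel_def image_image
      by (rule image_cong[OF refl], rule image_cong[OF refl]) (auto simp: g_def)
    have 3: "(`) g ` (`) (\<lambda>(r, i). (r, if r = Top then k + i else i)) ` p = p"
    proof -
      have "g ` (\<lambda>(r, i). (r, if r = Top then k + i else i)) ` B = B" if "B \<in> p" for B
      proof -
        have "g (case x of (r, i) \<Rightarrow> (r, if r = Top then k + i else i)) = x" if "x \<in> B" for x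
          using parts_block_subset[OF p \<open>B \<in> p\<close>] that by (auto simp: g_def)
        then show ?thesis unfolding image_image by simp
      qed
      then show ?thesis unfolding image_image by simp
    qed
    have 4: "(`) g ` (\<lambda>i. {(Top, i), (Bot, k + i)}) ` {..<k} = ?H"
      unfolding image_image by (rule image_cong) (auto simp: g_def)
    have "p1 \<otimes>\<^sub>P p2 = p1 \<union> relabel id (\<lambda>i. k + i) p2" using p1 by (simp add: tensor_def)
    then show ?thesis unfolding twist_eq[OF p] stack_def by (simp only: image_Un 1 2 3 4) blast
  qed
  moreover have "card (components ((stack p1 p2 \<union> p) \<union> ?H)) = card (components (stack p1 p2 \<union> p))"
  proof (rule card_components_add_singletons)
    have "\<Union>(stack p1 p2 \<union> p) = {Top, Mid, Bot} \<times> {..<k}"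
      using Union_stack[OF p1 p2] parts_Union[OF p] by auto
    then show "finite (\<Union>(stack p1 p2 \<union> p))" "\<And>B. B \<in> ?H \<Longrightarrow> \<exists>x\<in>\<Union>(stack p1 p2 \<union> p). B = {x}" by auto
  qed
  ultimately show ?thesis by simp
qed

text \<open>Let \<open>c\<close> count components. By the two contractions the left-hand side is the equation
  \<open>nc (p1 \<otimes>\<^sub>P p2) + c (ident k \<union> p) = c (ident (2 * k) \<union> p1 \<otimes>\<^sub>P p2) + c (stack p1 p2 \<union> p)\<close>, and
  the last term is \<open>c (r \<union> p) + c (stack p1 p2) - nc r\<close> for \<open>r = p1 \<circ>\<^sub>P p2\<close>. Adding and subtracting
  \<open>c (ident k \<union> r)\<close> splits the equation into the one for \<open>p1 \<otimes>\<^sub>P p2 \<le>\<^sub>P twist k r\<close> and the one for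
  \<open>r \<le>\<^sub>P p\<close>, in both of which one direction of the inequality always holds.\<close>

theorem tensor_le_twist_iff:
  assumes p1: "p1 \<in> parts k" and p2: "p2 \<in> parts k" and p: "p \<in> parts k"
  shows "p1 \<otimes>\<^sub>P p2 \<le>\<^sub>P twist k p \<longleftrightarrow> p1 \<circ>\<^sub>P p2 \<le>\<^sub>P p \<and> p1 \<otimes>\<^sub>P p2 \<le>\<^sub>P twist k (p1 \<circ>\<^sub>P p2)"
proof -
  let ?r = "p1 \<circ>\<^sub>P p2"
  have r: "?r \<in> parts k" by (rule comp_part_parts[OF p1 p2])
  have t: "p1 \<otimes>\<^sub>P p2 \<in> parts (2 * k)" by (rule tensor_parts_double[OF p1 p2])
  have "card (components (?r \<union> ?r)) = nc ?r" by (simp add: nc_def components_parts[OF r])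
  then show ?thesis
    using le_part_iff[OF t twist_parts[OF p]] le_part_iff[OF t twist_parts[OF r]] le_part_iff[OF r p]
      parts_triangle[OF t twist_parts[OF r]] parts_triangle[OF r p]
      card_components_stack[OF p1 p2 p] card_components_stack[OF p1 p2 r]
    unfolding card_components_ident_twist[OF p] card_components_ident_twist[OF r]
      card_components_tensor_twist[OF p1 p2 p] card_components_tensor_twist[OF p1 p2 r]
    by linarith
qed

section \<open>Sorting the columns of a diagram\<close>

definition rank_in :: "nat set \<Rightarrow> nat \<Rightarrow> nat" where
  "rank_in I i = card {j \<in> I. j < i}"

lemma rank_in_less:
  assumes "finite I" "i \<in> I" "i < j"
  shows "rank_in I i < rank_in I j"
  unfolding rank_in_def using assms by (intro psubset_card_mono) auto

lemma inj_on_rank_in: "finite I \<Longrightarrow> inj_on (rank_in I) I"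
  by (rule linorder_inj_onI) (auto dest: rank_in_less)

lemma rank_in_less_card:
  assumes "finite I" "i \<in> I"
  shows "rank_in I i < card I"
  unfolding rank_in_def using assms by (intro psubset_card_mono) auto

lemma rank_in_image: "finite I \<Longrightarrow> rank_in I ` I = {..<card I}"
  by (rule card_subset_eq) (auto simp: rank_in_less_card card_image inj_on_rank_in)

text \<open>Relabelling by this permutation brings a diagram that \<open>I\<close> splits into the form of a tensor
  product, see \<open>relabel_column_sort\<close>.\<close>

definition column_sort :: "nat \<Rightarrow> nat set \<Rightarrow> nat \<Rightarrow> nat" where
  "column_sort k I i =
    (if i \<in> I then rank_in I i else if i < k then card I + rank_in ({..<k} - I) i else i)"

lemma card_Diff_lessThan: "I \<subseteq> {..<k} \<Longrightarrow> card ({..<k} - I) = k - card I"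
  by (simp add: card_Diff_subset finite_subset)

lemma card_le_lessThan: "I \<subseteq> {..<k :: nat} \<Longrightarrow> card I \<le> k"
  using card_mono[of "{..<k}" I] by simp

lemma column_sort_permutes:
  assumes I: "I \<subseteq> {..<k}"
  shows "column_sort k I permutes {..<k}"
proof (rule inj_imp_permutes)
  have fin: "finite I" "finite ({..<k} - I)" using I finite_subset by auto
  note less = rank_in_less_card[OF fin(1)] rank_in_less_card[OF fin(2)]
  show "inj_on (column_sort k I) {..<k}"
  proof (rule inj_onI)
    fix i j assume ij: "i \<in> {..<k}" "j \<in> {..<k}" "column_sort k I i = column_sort k I j"
    show "i = j"
      using ij less(1)[of i] less(1)[of j] inj_onD[OF inj_on_rank_in[OF fin(1)], of i j]
        inj_onD[OF inj_on_rank_in[OF fin(2)], of i j]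
      by (auto simp: column_sort_def split: if_splits)
  qed
  show "column_sort k I i \<in> {..<k}" if "i \<in> {..<k}" for i
    using that less(1)[of i] less(2)[of i] card_le_lessThan[OF I]
    by (auto simp: column_sort_def card_Diff_lessThan[OF I])
  show "column_sort k I i = i" if "i \<notin> {..<k}" for i
    using that I by (auto simp: column_sort_def)
qed simp

lemma column_sort_lessThan: "column_sort (2 * k) {..<k} = id"
proof
  fix i
  have "{j. j < k \<and> j < i} = {..<i}" if "i < k" using that by auto
  moreover have "{j \<in> {..<2 * k} - {..<k}. j < i} = {k..<i}" if "k \<le> i" "i < 2 * k" using that by auto
  ultimately show "column_sort (2 * k) {..<k} i = id i"
    by (auto simp: column_sort_def rank_in_def)
qed

text \<open>A block that meets both the columns in \<open>I\<close> and other columns is called cut; cut blocks are what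
  freeness and \<open>F2\<close> exclude.\<close>

definition splits :: "diagram \<Rightarrow> nat set \<Rightarrow> bool" where
  "splits p I \<longleftrightarrow> (\<forall>B\<in>p. B \<subseteq> UNIV \<times> I \<or> B \<inter> UNIV \<times> I = {})"

lemma extraction_eq: "extraction p I = relabel id (rank_in I) ((\<lambda>B. B \<inter> {Top, Bot} \<times> I) ` p - {{}})"
  unfolding extraction_def rank_in_def ..

lemma inj_on_map_prod_rank_in: "finite I \<Longrightarrow> inj_on (map_prod id (rank_in I)) (R \<times> I)"
  by (rule map_prod_inj_on) (auto simp: inj_on_rank_in)

lemma extraction_parts:
  assumes p: "p \<in> parts k" and I: "I \<subseteq> {..<k}"
  shows "extraction p I \<in> parts (card I)"
proof -
  have fin: "finite I" using I finite_subset by auto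
  have "partition_on ({Top, Bot} \<times> {..<k}) p" using p by (simp add: parts_def)
  from partition_on_restrict[OF this, of "{Top, Bot} \<times> I"]
  have "partition_on ({Top, Bot} \<times> I) ((\<lambda>B. B \<inter> {Top, Bot} \<times> I) ` p - {{}})"
    using I by (simp add: Int_commute Times_Int_Times Int_absorb2 Int_absorb1)
  from partition_on_relabel[OF this inj_on_map_prod_rank_in[OF fin]]
  show ?thesis
    unfolding extraction_eq parts_def by (simp add: map_prod_surj_on[OF refl refl] rank_in_image[OF fin])
qed

lemma nc_extraction:
  assumes p: "p \<in> parts k" and I: "I \<subseteq> {..<k}"
  shows "nc (extraction p I) = card {B \<in> p. B \<inter> {Top, Bot} \<times> I \<noteq> {}}"
proof -
  let ?V = "{Top, Bot} \<times> I"
  have fin: "finite I" using I finite_subset by auto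
  have "inj_on ((`) (map_prod id (rank_in I))) ((\<lambda>B. B \<inter> ?V) ` p - {{}})"
    by (rule inj_on_subset[OF inj_on_image_Pow[OF inj_on_map_prod_rank_in[OF fin, of "{Top, Bot}"]]]) auto
  then have "nc (extraction p I) = card ((\<lambda>B. B \<inter> ?V) ` p - {{}})"
    unfolding extraction_eq nc_def relabel_def by (rule card_image)
  also have "(\<lambda>B. B \<inter> ?V) ` p - {{}} = (\<lambda>B. B \<inter> ?V) ` {B \<in> p. B \<inter> ?V \<noteq> {}}" by blast
  also have "card \<dots> = card {B \<in> p. B \<inter> ?V \<noteq> {}}"
  proof (rule card_image, rule inj_onI)
    fix B B' assume B: "B \<in> {B \<in> p. B \<inter> ?V \<noteq> {}}" "B' \<in> {B \<in> p. B \<inter> ?V \<noteq> {}}" "B \<inter> ?V = B' \<inter> ?V"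
    then obtain x where "x \<in> B" "x \<in> B'" by blast
    moreover have "disjoint p" using p by (simp add: parts_def partition_on_def)
    ultimately show "B = B'" using B(1,2) by (metis (no_types, lifting) IntI disjointD empty_iff mem_Collect_eq)
  qed
  finally show ?thesis .
qed

text \<open>Counted with both extractions, a block contributes twice iff it is cut.\<close>

lemma nc_extractions_iff_splits:
  assumes p: "p \<in> parts k" and I: "I \<subseteq> {..<k}"
  shows "nc (extraction p I) + nc (extraction p ({..<k} - I)) = nc p \<longleftrightarrow> splits p I"
proof -
  let ?A = "{B \<in> p. B \<inter> {Top, Bot} \<times> I \<noteq> {}}" and ?B = "{B \<in> p. B \<inter> {Top, Bot} \<times> ({..<k} - I) \<noteq> {}}"
  have finp: "finite p" using finite_elements[of "{Top, Bot} \<times> {..<k}" p] p by (simp add: parts_def)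
  have sub: "B \<subseteq> {Top, Bot} \<times> {..<k}" "B \<noteq> {}" if "B \<in> p" for B
    using parts_block_subset[OF p that] parts_nonempty[OF p] that by auto
  have "?A \<union> ?B = p"
  proof -
    have "B \<in> ?A \<union> ?B" if B: "B \<in> p" for B
    proof -
      obtain r i where "(r, i) \<in> B" using sub(2)[OF B] by auto
      then show ?thesis using sub(1)[OF B] B by (cases "i \<in> I") auto
    qed
    then show ?thesis by blast
  qed
  then have "card ?A + card ?B = card p + card (?A \<inter> ?B)"
    using card_Un_Int[of ?A ?B] finp by simp
  moreover have "?A \<inter> ?B = {} \<longleftrightarrow> splits p I"
  proof -
    have e: "B \<inter> {Top, Bot} \<times> I = B \<inter> UNIV \<times> I" "B \<inter> {Top, Bot} \<times> ({..<k} - I) = B - UNIV \<times> I"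
      if "B \<in> p" for B
      using sub(1)[OF that] by auto
    have A: "?A = {B \<in> p. B \<inter> UNIV \<times> I \<noteq> {}}"
      by (rule Collect_cong) (metis e(1))
    have B: "?B = {B \<in> p. B - UNIV \<times> I \<noteq> {}}"
      by (rule Collect_cong) (metis e(2))
    have "{B \<in> p. X B \<noteq> {}} \<inter> {B \<in> p. Y B \<noteq> {}} = {} \<longleftrightarrow> (\<forall>B\<in>p. Y B = {} \<or> X B = {})"
      for X Y :: "point set \<Rightarrow> point set" by blast
    from this[of "\<lambda>B. B \<inter> UNIV \<times> I" "\<lambda>B. B - UNIV \<times> I"] show ?thesis
      unfolding splits_def A B Diff_eq_empty_iff .
  qed
  ultimately show ?thesis
    unfolding nc_extraction[OF p I] nc_extraction[OF p Diff_subset] unfolding nc_def using finp by auto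
qed

lemma relabel_column_sort:
  assumes p: "p \<in> parts k" and I: "I \<subseteq> {..<k}" and s: "splits p I"
  shows "relabel id (column_sort k I) p = extraction p I \<otimes>\<^sub>P extraction p ({..<k} - I)"
proof -
  let ?J = "{..<k} - I"
  define pI where "pI = {B \<in> p. B \<subseteq> {Top, Bot} \<times> I}"
  define pJ where "pJ = {B \<in> p. B \<subseteq> {Top, Bot} \<times> ?J}"
  have sub: "B \<subseteq> {Top, Bot} \<times> {..<k}" "B \<noteq> {}" if "B \<in> p" for B
    using parts_block_subset[OF p that] parts_nonempty[OF p] that by auto
  have dich: "B \<subseteq> {Top, Bot} \<times> I \<or> B \<subseteq> {Top, Bot} \<times> ?J" if B: "B \<in> p" for B
    using s sub[OF B] B unfolding splits_def by fastforce
  have pIJ: "p = pI \<union> pJ" unfolding pI_def pJ_def using dich by blast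
  have I1: "B \<inter> {Top, Bot} \<times> I = B" "B \<inter> {Top, Bot} \<times> ?J = {}" if "B \<in> pI" for B
    using that unfolding pI_def by auto
  have J1: "B \<inter> {Top, Bot} \<times> I = {}" "B \<inter> {Top, Bot} \<times> ?J = B" if "B \<in> pJ" for B
    using that unfolding pJ_def by auto
  have ne: "{} \<notin> pI" "{} \<notin> pJ" using sub(2) unfolding pI_def pJ_def by blast+
  have "(\<lambda>B. B \<inter> {Top, Bot} \<times> I) ` p - {{}} = pI"
    unfolding pIJ image_Un using I1(1) J1(1) ne by auto
  then have eI: "extraction p I = relabel id (rank_in I) pI" by (simp add: extraction_eq)
  have "(\<lambda>B. B \<inter> {Top, Bot} \<times> ?J) ` p - {{}} = pJ"
    unfolding pIJ image_Un using I1(2) J1(2) ne by auto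
  then have eJ: "extraction p ?J = relabel id (rank_in ?J) pJ" by (simp add: extraction_eq)
  have "relabel id (column_sort k I) pI = relabel id (rank_in I) pI"
    unfolding relabel_def
  proof (rule image_cong[OF refl], rule image_cong[OF refl])
    fix B x assume "B \<in> pI" "x \<in> B"
    then show "map_prod id (column_sort k I) x = map_prod id (rank_in I) x"
      unfolding pI_def by (cases x) (auto simp: column_sort_def)
  qed
  moreover have "relabel id (column_sort k I) pJ = relabel id (\<lambda>i. card I + i) (relabel id (rank_in ?J) pJ)"
    unfolding relabel_def image_image
  proof (rule image_cong[OF refl], rule image_cong[OF refl])
    fix B x assume "B \<in> pJ" "x \<in> B"
    then show "map_prod id (column_sort k I) x = map_prod id (\<lambda>i. card I + i) (map_prod id (rank_in ?J) x)"
      unfolding pJ_def by (cases x) (auto simp: column_sort_def)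
  qed
  moreover have "relabel id (column_sort k I) p = relabel id (column_sort k I) pI \<union> relabel id (column_sort k I) pJ"
    unfolding pIJ relabel_def by (simp add: image_Un)
  ultimately show ?thesis
    unfolding tensor_def deg_parts[OF extraction_parts[OF p I]] unfolding eI eJ by simp
qed

lemma splits_lessThan_imp_tensor:
  assumes P: "P \<in> parts (2 * k)" and s: "splits P {..<k}"
  shows "\<exists>p1\<in>parts k. \<exists>p2\<in>parts k. P = p1 \<otimes>\<^sub>P p2"
proof (intro bexI)
  have I: "{..<k} \<subseteq> {..<2 * k}" by auto
  show "P = extraction P {..<k} \<otimes>\<^sub>P extraction P ({..<2 * k} - {..<k})"
    using relabel_column_sort[OF P I s] unfolding column_sort_lessThan by (simp add: relabel_def map_prod.id)
  show "extraction P {..<k} \<in> parts k" using extraction_parts[OF P I] by simp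
  show "extraction P ({..<2 * k} - {..<k}) \<in> parts k"
    using extraction_parts[OF P Diff_subset, of "{..<k}"] card_Diff_lessThan[OF I] by simp
qed

lemma tensor_inject:
  assumes p: "p1 \<in> parts k" and q: "q1 \<in> parts k" and l: "p2 \<in> parts l" "q2 \<in> parts l"
    and eq: "p1 \<otimes>\<^sub>P p2 = q1 \<otimes>\<^sub>P q2"
  shows "p1 = q1 \<and> p2 = q2"
proof -
  let ?V = "{Top, Bot} \<times> {..<k}"
  have split: "{B \<in> p \<otimes>\<^sub>P p'. B \<subseteq> ?V} = p" "{B \<in> p \<otimes>\<^sub>P p'. \<not> B \<subseteq> ?V} = relabel id (\<lambda>i. k + i) p'"
    if p: "p \<in> parts k" and p': "p' \<in> parts l" for p p'
  proof -
    have "\<not> B \<subseteq> ?V" if B: "B \<in> relabel id (\<lambda>i. k + i) p'" for B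
    proof -
      obtain B' where B': "B' \<in> p'" "B = map_prod id (\<lambda>i. k + i) ` B'" using B by (auto simp: relabel_def)
      then obtain r i where "(r, i) \<in> B'" using parts_nonempty[OF p'] by (metis equals0I surj_pair)
      then have "(r, k + i) \<in> B" unfolding B'(2) by force
      then show ?thesis by auto
    qed
    moreover have "p \<otimes>\<^sub>P p' = p \<union> relabel id (\<lambda>i. k + i) p'" using p by (simp add: tensor_def)
    ultimately show "{B \<in> p \<otimes>\<^sub>P p'. B \<subseteq> ?V} = p" "{B \<in> p \<otimes>\<^sub>P p'. \<not> B \<subseteq> ?V} = relabel id (\<lambda>i. k + i) p'"
      using parts_block_subset[OF p] by auto
  qed
  have "inj ((`) (map_prod id ((+) k)) :: point set \<Rightarrow> _)"
    by (auto intro!: injI simp: inj_image_eq_iff prod.inj_map)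
  then have "inj (relabel id (\<lambda>i. k + i))"
    unfolding relabel_def by (auto intro!: injI simp: inj_image_eq_iff)
  moreover have "relabel id (\<lambda>i. k + i) p2 = relabel id (\<lambda>i. k + i) q2"
    using split(2)[OF p l(1)] split(2)[OF q l(2)] eq by simp
  ultimately show ?thesis
    using split(1)[OF p l(1)] split(1)[OF q l(2)] eq by (auto dest: injD)
qed

section \<open>Cumulants of free elements\<close>

context P_tracial_algebra
begin

abbreviation \<kappa> where "\<kappa> \<equiv> cumulant scale m"

lemma tracial: "P_tracial_algebra scale m" ..

lemma moment_cumulant:
  "p \<in> parts k \<Longrightarrow> length xs = k \<Longrightarrow> m p xs = (\<Sum>q | q \<in> parts k \<and> q \<le>\<^sub>P p. \<kappa> q xs)"
  using cumulant_is_cumulants[OF tracial] unfolding is_cumulants_def by blast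

lemma cumulant_multilinear: "p \<in> parts k \<Longrightarrow> multilinear_form scale k (\<kappa> p)"
  using cumulant_is_cumulants[OF tracial] unfolding is_cumulants_def by blast

lemma R_transform_eq: "p \<in> parts k \<Longrightarrow> R_transform scale m a p = \<kappa> p (replicate k a)"
  by (auto simp: R_transform_def all_parts_def)

text \<open>Relabelling preserves the order, so both sides, as functions of \<open>p\<close>, solve the
  same triangular system, whose right-hand side is given by the moments and is invariant by the
  trace property.\<close>

lemma cumulant_relabel:
  assumes s: "\<sigma> permutes {..<k}" and p: "p \<in> parts k" and xs: "length xs = k"
  shows "\<kappa> (relabel id \<sigma> p) (permute_list (inv \<sigma>) xs) = \<kappa> p xs"
proof (rule triangular_unique[OF _ p, of "\<lambda>p. \<kappa> (relabel id \<sigma> p) (permute_list (inv \<sigma>) xs)"])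
  fix p assume p: "p \<in> parts k"
  let ?ys = "permute_list (inv \<sigma>) xs"
  have ys: "length ?ys = k" using xs by simp
  have rel: "m p zs = \<kappa> p zs + (\<Sum>q\<in>below k p. \<kappa> q zs)" if "p \<in> parts k" "length zs = k" for p zs
    using moment_cumulant[OF that] that(1) by (simp add: sum_le_part)
  have r: "relabel id \<sigma> q \<in> parts k" if "q \<in> parts k" for q
    using relabel_perm_parts[OF s that] .
  have inj: "inj_on (relabel id \<sigma>) (parts k)"
  proof (rule inj_onI)
    fix x y assume "relabel id \<sigma> x = relabel id \<sigma> y"
    then show "x = y"
      unfolding relabel_def using inj_map_prod_perm[OF s] by (simp add: inj_image_eq_iff inj_def)
  qed
  have surj: "relabel id \<sigma> ` parts k = parts k"
    using r by (intro endo_inj_surj[OF finite_parts _ inj]) blast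
  have img: "relabel id \<sigma> ` below k p = below k (relabel id \<sigma> p)"
  proof
    show "relabel id \<sigma> ` below k p \<subseteq> below k (relabel id \<sigma> p)"
      using r p le_part_relabel[OF s] inj by (auto simp: below_def dest: inj_onD)
    show "below k (relabel id \<sigma> p) \<subseteq> relabel id \<sigma> ` below k p"
    proof
      fix q assume q: "q \<in> below k (relabel id \<sigma> p)"
      then have "q \<in> relabel id \<sigma> ` parts k" unfolding surj by (simp add: below_def)
      then obtain q' where "q' \<in> parts k" "q = relabel id \<sigma> q'" by blast
      then show "q \<in> relabel id \<sigma> ` below k p"
        using q le_part_relabel[OF s _ p] by (auto simp: below_def)
    qed
  qed
  have "m (relabel id \<sigma> p) ?ys = m p xs"
    using m_conj[OF p xs s] conj_part_eq_relabel[OF s p] p by (simp add: conj_part_def)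
  then have "\<kappa> (relabel id \<sigma> p) ?ys + (\<Sum>q\<in>below k (relabel id \<sigma> p). \<kappa> q ?ys)
      = \<kappa> p xs + (\<Sum>q\<in>below k p. \<kappa> q xs)"
    using rel[OF p xs] rel[OF r[OF p] ys] by simp
  moreover have "(\<Sum>q\<in>below k (relabel id \<sigma> p). \<kappa> q ?ys) = (\<Sum>q\<in>below k p. \<kappa> (relabel id \<sigma> q) ?ys)"
    unfolding img[symmetric]
    by (rule sum.reindex[unfolded o_def]) (rule inj_on_subset[OF inj], auto simp: below_def)
  ultimately show "\<kappa> (relabel id \<sigma> p) ?ys + (\<Sum>q\<in>below k p. \<kappa> (relabel id \<sigma> q) ?ys)
      = \<kappa> p xs + (\<Sum>q\<in>below k p. \<kappa> q xs)" by simp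
qed

end

locale P_free_elements = P_tracial_algebra scale m
  for scale :: "complex \<Rightarrow> 'a::ring \<Rightarrow> 'a" and m +
  fixes a b :: 'a
  assumes free: "P_free scale m a b"
begin

lemma hull_self: "x \<in> subalgebra scale hull {x}"
  by (rule hull_inc) simp

definition word :: "nat \<Rightarrow> nat set \<Rightarrow> 'a list" where
  "word k I = map (\<lambda>i. if i \<in> I then a else b) [0..<k]"

text \<open>A block that is cut connects, through the columns of the identity, a top point that carries
  \<open>a\<close> with one that carries \<open>b\<close> within one cycle.\<close>

lemma cumulant_vanishes:
  assumes p: "p \<in> parts k" and I: "I \<subseteq> {..<k}" and s: "\<not> splits p I"
  shows "\<kappa> p (word k I) = 0"
proof -
  define \<epsilon> :: "nat \<Rightarrow> nat" where "\<epsilon> i = (if i \<in> I then 1 else 2)" for i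
  obtain B where "B \<in> p" "\<not> B \<subseteq> UNIV \<times> I" "B \<inter> UNIV \<times> I \<noteq> {}"
    using s unfolding splits_def by blast
  moreover then obtain r i r' j where "(r, i) \<in> B" "(r', j) \<in> B" "i \<in> I" "j \<notin> I" by auto
  ultimately have B: "B \<in> p" "(r, i) \<in> B" "(r', j) \<in> B" "i \<in> I" "j \<notin> I" by auto
  let ?F = "p \<union> ident k"
  have cyc: "cycles p = components ?F" using p by (simp add: cycles_def join_def)
  have "B \<noteq> {}" using B by auto
  then obtain c where c: "c \<in> components ?F" "B \<subseteq> c" using components_upper[of B ?F] B(1) by auto
  have top: "(Top, n) \<in> c" if "(s, n) \<in> B" for s n
  proof -
    have sn: "s = Top \<or> s = Bot" "n < k" using parts_block_subset[OF p B(1)] that by auto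
    then have "{(Top, n), (Bot, n)} \<in> ?F" by (auto simp: ident_def perm_part_image)
    then obtain c' where c': "c' \<in> components ?F" "{(Top, n), (Bot, n)} \<subseteq> c'"
      using components_upper by (metis insert_not_empty)
    then have "(s, n) \<in> c'" using sn(1) by auto
    then have "c' = c" using component_eqI[OF c'(1) c(1)] c(2) that by blast
    then show ?thesis using c'(2) by blast
  qed
  have ex: "\<exists>c\<in>cycles p. \<exists>i j. (Top, i) \<in> c \<and> (Top, j) \<in> c \<and> \<epsilon> i \<noteq> \<epsilon> j"
    unfolding cyc using top[OF B(2)] top[OF B(3)] B(4,5) c(1) by (auto simp: \<epsilon>_def intro!: bexI[of _ c])
  have "\<forall>i<k. \<epsilon> i \<in> {1, 2} \<and> word k I ! i \<in> (if \<epsilon> i = 1 then subalgebra scale hull {a} else subalgebra scale hull {b})"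
    using hull_self by (auto simp: word_def \<epsilon>_def)
  moreover have "length (word k I) = k" by (simp add: word_def)
  ultimately show ?thesis
    using free p ex unfolding P_free_def P_free_algebras_def by blast
qed

lemma cumulant_tensor:
  assumes "p1 \<in> parts k" "p2 \<in> parts l"
  shows "\<kappa> (p1 \<otimes>\<^sub>P p2) (replicate k a @ replicate l b) = R_transform scale m a p1 * R_transform scale m b p2"
proof -
  have "set (replicate k a) \<subseteq> subalgebra scale hull {a}" "set (replicate l b) \<subseteq> subalgebra scale hull {b}"
    using hull_self by (auto simp: set_replicate_conv_if)
  then show ?thesis
    using free assms unfolding P_free_def P_free_algebras_def
    by (simp add: R_transform_eq[OF assms(1)] R_transform_eq[OF assms(2)])
qed

lemma permute_word:
  assumes I: "I \<subseteq> {..<k}"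
  shows "permute_list (inv (column_sort k I)) (word k I) = replicate (card I) a @ replicate (k - card I) b"
    (is "?l = ?r")
proof (rule nth_equalityI)
  note s = column_sort_permutes[OF I]
  have cI: "card I \<le> k" by (rule card_le_lessThan[OF I])
  have fin: "finite I" using I finite_subset by auto
  show "length ?l = length ?r" using cI by (simp add: word_def)
  fix i assume "i < length ?l"
  then have i: "i < k" by (simp add: word_def)
  define j where "j = inv (column_sort k I) i"
  have j: "j < k" "column_sort k I j = i"
    using permutes_in_image[OF permutes_inv[OF s], of i] permutes_inverses(1)[OF s, of i] i by (auto simp: j_def)
  have "?l ! i = word k I ! j" using i by (simp add: permute_list_def word_def j_def)
  also have "\<dots> = (if j \<in> I then a else b)" using j(1) by (simp add: word_def)
  also have "j \<in> I \<longleftrightarrow> i < card I"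
    using j rank_in_less_card[OF fin, of j] by (auto simp: column_sort_def split: if_splits)
  finally show "?l ! i = ?r ! i" using i cI by (simp add: nth_append)
qed

lemma cumulant_word:
  assumes p: "p \<in> parts k" and I: "I \<subseteq> {..<k}"
  shows "\<kappa> p (word k I) = (if splits p I
    then R_transform scale m a (extraction p I) * R_transform scale m b (extraction p ({..<k} - I)) else 0)"
proof (cases "splits p I")
  case True
  have "\<kappa> p (word k I) = \<kappa> (relabel id (column_sort k I) p) (replicate (card I) a @ replicate (k - card I) b)"
    using cumulant_relabel[OF column_sort_permutes[OF I] p, of "word k I"] permute_word[OF I]
    by (simp add: word_def)
  also have "\<dots> = R_transform scale m a (extraction p I) * R_transform scale m b (extraction p ({..<k} - I))"
    unfolding relabel_column_sort[OF p I True]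
    using extraction_parts[OF p I] extraction_parts[OF p Diff_subset, of I] card_Diff_lessThan[OF I]
    by (intro cumulant_tensor) simp_all
  finally show ?thesis using True by simp
qed (simp add: cumulant_vanishes[OF p I])

end

section \<open>Sums of free elements\<close>

lemma (in complex_algebra) multilinear_form_fun_upd:
  assumes f: "multilinear_form scale k f" and j: "j < k"
  shows "f (map (g(j := x + y)) [0..<k]) = f (map (g(j := x)) [0..<k]) + f (map (g(j := y)) [0..<k])"
proof -
  have "(map g [0..<k])[j := z] = map (g(j := z)) [0..<k]" for z
    by (rule nth_equalityI) (auto simp: nth_list_update)
  moreover have "length (map g [0..<k]) = k" by simp
  then have "Vector_Spaces.linear scale (*) (\<lambda>x. f ((map g [0..<k])[j := x]))"
    using f j unfolding multilinear_form_def by blast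
  ultimately show ?thesis
    using linear_iff_vs[OF vector_space_axioms] by simp
qed

text \<open>The function \<open>g\<close> fills the positions outside \<open>J\<close>. It is arbitrary in the induction, because the
  position that is added to \<open>J\<close> is treated by overriding \<open>g\<close> there with one of the summands.\<close>

lemma (in complex_algebra) multilinear_form_expand:
  assumes f: "multilinear_form scale k f" and J: "J \<subseteq> {..<k}"
  shows "f (map (\<lambda>i. if i \<in> J then a + b else g i) [0..<k])
    = (\<Sum>I\<in>Pow J. f (map (\<lambda>i. if i \<in> I then a else if i \<in> J then b else g i) [0..<k]))"
  using finite_subset[OF J finite_lessThan] J
proof (induction J arbitrary: g rule: finite_induct)
  case (insert j J)
  let ?h = "\<lambda>i. if i \<in> J then a + b else g i"
  let ?s = "\<lambda>g I i. if i \<in> I then a else if i \<in> J then b else g i"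
  have j: "j < k" and J: "J \<subseteq> {..<k}" using insert.prems by auto
  have up: "?h(j := z) = (\<lambda>i. if i \<in> J then a + b else (g(j := z)) i)" for z
    using insert.hyps by (auto simp: fun_eq_iff)
  have "(\<lambda>i. if i \<in> insert j J then a + b else g i) = ?h(j := a + b)"
    using insert.hyps by (auto simp: fun_eq_iff)
  then have "f (map (\<lambda>i. if i \<in> insert j J then a + b else g i) [0..<k])
     = f (map (?h(j := a)) [0..<k]) + f (map (?h(j := b)) [0..<k])"
    using multilinear_form_fun_upd[OF f j, of ?h a b] by simp
  also have "\<dots> = (\<Sum>I\<in>Pow J. f (map (?s (g(j := a)) I) [0..<k])) + (\<Sum>I\<in>Pow J. f (map (?s (g(j := b)) I) [0..<k]))"
    unfolding up insert.IH[OF J] ..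
  also have "(\<Sum>I\<in>Pow J. f (map (?s (g(j := a)) I) [0..<k]))
     = (\<Sum>I\<in>insert j ` Pow J. f (map (\<lambda>i. if i \<in> I then a else if i \<in> insert j J then b else g i) [0..<k]))"
  proof -
    have inj: "inj_on (insert j) (Pow J)"
      using insert.hyps(2) by (auto simp: inj_on_def)
    have "?s (g(j := a)) I = (\<lambda>i. if i \<in> insert j I then a else if i \<in> insert j J then b else g i)"
      if "I \<in> Pow J" for I
      using insert.hyps(2) that by (auto simp: fun_eq_iff)
    then show ?thesis unfolding sum.reindex[OF inj] o_def by (intro sum.cong) auto
  qed
  also have "(\<Sum>I\<in>Pow J. f (map (?s (g(j := b)) I) [0..<k]))
     = (\<Sum>I\<in>Pow J. f (map (\<lambda>i. if i \<in> I then a else if i \<in> insert j J then b else g i) [0..<k]))"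
  proof (rule sum.cong[OF refl])
    fix I assume "I \<in> Pow J"
    then have "?s (g(j := b)) I = (\<lambda>i. if i \<in> I then a else if i \<in> insert j J then b else g i)"
      using insert.hyps(2) by (auto simp: fun_eq_iff)
    then show "f (map (?s (g(j := b)) I) [0..<k])
      = f (map (\<lambda>i. if i \<in> I then a else if i \<in> insert j J then b else g i) [0..<k])" by simp
  qed
  finally show ?case
    unfolding Pow_insert using insert.hyps
    by (subst sum.union_disjoint) (auto simp: add.commute)
qed simp

context P_free_elements
begin

theorem R_transform_add:
  "R_transform scale m (a + b) = R_transform scale m a \<boxplus> R_transform scale m b"
proof
  fix p
  show "R_transform scale m (a + b) p = (R_transform scale m a \<boxplus> R_transform scale m b) p"
  proof (cases "p \<in> all_parts")
    case True
    then obtain k where p: "p \<in> parts k" by (auto simp: all_parts_def)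
    let ?f = "\<lambda>I. R_transform scale m a (extraction p I) * R_transform scale m b (extraction p ({..<k} - I))"
    have "replicate k (a + b) = map (\<lambda>i. if i \<in> {..<k} then a + b else 0) [0..<k]"
      by (rule nth_equalityI) auto
    then have "R_transform scale m (a + b) p = \<kappa> p (map (\<lambda>i. if i \<in> {..<k} then a + b else 0) [0..<k])"
      by (simp only: R_transform_eq[OF p])
    also have "\<dots> = (\<Sum>I\<in>Pow {..<k}. \<kappa> p (map (\<lambda>i. if i \<in> I then a else if i \<in> {..<k} then b else 0) [0..<k]))"
      by (rule multilinear_form_expand[OF cumulant_multilinear[OF p] subset_refl])
    also have "\<dots> = (\<Sum>I\<in>Pow {..<k}. \<kappa> p (word k I))"
      unfolding word_def by (intro sum.cong refl arg_cong2[of _ _ _ _ \<kappa>] map_cong) auto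
    also have "\<dots> = (\<Sum>I\<in>Pow {..<k}. if splits p I then ?f I else 0)"
      by (rule sum.cong[OF refl]) (simp only: PowD cumulant_word[OF p] Pow_iff)
    also have "\<dots> = (\<Sum>I\<in>{I \<in> Pow {..<k}. splits p I}. ?f I)"
      by (rule sum.inter_filter[symmetric]) simp
    also have "\<dots> = (\<Sum>(p1, p2, I)\<in>F2 p. R_transform scale m a p1 * R_transform scale m b p2)"
    proof -
      let ?t = "\<lambda>I. (extraction p I, extraction p ({..<k} - I), I)"
      have "F2 p = ?t ` {I \<in> Pow {..<k}. splits p I}"
        unfolding F2_def deg_parts[OF p] using nc_extractions_iff_splits[OF p] by auto
      moreover have "inj_on ?t {I \<in> Pow {..<k}. splits p I}" by (rule inj_onI) simp
      ultimately show ?thesis by (simp add: sum.reindex)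
    qed
    finally show ?thesis using True by (simp add: boxplus_def)
  qed (simp add: R_transform_def boxplus_def)
qed

end

section \<open>Products of free elements\<close>

lemma word_start_replicate: "j \<le> k \<Longrightarrow> word_start (replicate k n) j = n * j"
  by (simp add: word_start_def sum_list_replicate min_def)

lemma word_cycles_pairs:
  "word_cycles (replicate k 2) = (\<lambda>i. if i < 2 * k then if even i then Suc i else i - 1 else i)"
proof -
  let ?c = "\<lambda>j. transpose (2 * j) (Suc (2 * j)) :: nat \<Rightarrow> nat"
  have "map (\<lambda>j. cycle_of_list [word_start (replicate k 2) j..<word_start (replicate k 2) (Suc j)]) [0..<k]
     = map ?c [0..<k]"
  proof (rule map_cong[OF refl])
    fix j assume "j \<in> set [0..<k]"
    then have "[word_start (replicate k 2) j..<word_start (replicate k 2) (Suc j)] = [2 * j, Suc (2 * j)]"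
      by (simp add: word_start_replicate upt_conv_Cons)
    then show "cycle_of_list [word_start (replicate k 2) j..<word_start (replicate k 2) (Suc j)] = ?c j"
      by simp
  qed
  then have "word_cycles (replicate k 2) = foldr (\<circ>) (map ?c [0..<k]) id"
    by (simp only: word_cycles_def length_replicate)
  also have "\<dots> = (\<lambda>i. if i < 2 * k then if even i then Suc i else i - 1 else i)"
  proof (induction k)
    case (Suc k)
    have fo: "foldr (\<circ>) fs f = foldr (\<circ>) fs id \<circ> f" for fs and f :: "nat \<Rightarrow> nat"
      by (induction fs) auto
    have "foldr (\<circ>) (map ?c [0..<Suc k]) id = foldr (\<circ>) (map ?c [0..<k]) id \<circ> ?c k"
      using fo[of "map ?c [0..<k]" "?c k"] by simp
    also have "\<dots> = (\<lambda>i. if i < 2 * Suc k then if even i then Suc i else i - 1 else i)"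
    proof
      fix i
      have "i < 2 * k \<or> i = 2 * k \<or> i = Suc (2 * k) \<or> 2 * Suc k \<le> i" by auto
      then consider "i < 2 * k" | "i = 2 * k" | "i = Suc (2 * k)" | "2 * Suc k \<le> i" by blast
      then show "(foldr (\<circ>) (map ?c [0..<k]) id \<circ> ?c k) i = (if i < 2 * Suc k then if even i then Suc i else i - 1 else i)"
        by cases (auto simp: Suc.IH transpose_def)
    qed
    finally show ?case .
  qed auto
  finally show ?thesis .
qed

text \<open>The words \<open>ab\<close> in the arguments produce the sequence \<open>a, b, a, b, \<dots>\<close>. Un-interleaving the
  columns collects the letters \<open>a\<close> on the left and the letters \<open>b\<close> on the right.\<close>

definition interleave :: "nat \<Rightarrow> nat \<Rightarrow> nat" where
  "interleave k i = (if i < k then 2 * i else if i < 2 * k then Suc (2 * (i - k)) else i)"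

definition uninterleave :: "nat \<Rightarrow> nat \<Rightarrow> nat" where
  "uninterleave k i = (if i < 2 * k then if even i then i div 2 else k + i div 2 else i)"

lemma uninterleave_interleave: "uninterleave k (interleave k i) = i"
  by (auto simp: interleave_def uninterleave_def)

lemma interleave_uninterleave: "interleave k (uninterleave k i) = i"
  by (auto simp: interleave_def uninterleave_def)

lemma interleave_permutes: "interleave k permutes {..<2 * k}"
proof (rule inj_imp_permutes)
  show "inj_on (interleave k) {..<2 * k}" by (metis uninterleave_interleave inj_on_inverseI)
qed (auto simp: interleave_def)

lemma uninterleave_permutes: "uninterleave k permutes {..<2 * k}"
proof (rule inj_imp_permutes)
  show "inj_on (uninterleave k) {..<2 * k}" by (metis interleave_uninterleave inj_on_inverseI)
qed (auto simp: uninterleave_def)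

lemma inv_uninterleave: "inv (uninterleave k) = interleave k"
  by (rule inv_unique_comp) (auto simp: fun_eq_iff uninterleave_interleave interleave_uninterleave)

lemma insert_part_even:
  assumes p: "p \<in> parts k"
  shows "insert_part (2 * k) (map (\<lambda>j. 2 * j) [0..<k]) p = relabel id (interleave k) (p \<otimes>\<^sub>P ident k)"
proof -
  have 1: "relabel id (\<lambda>j. map (\<lambda>j. 2 * j) [0..<k] ! j) p = relabel id (interleave k) p"
    unfolding relabel_def
  proof (rule image_cong[OF refl], rule image_cong[OF refl])
    fix B x assume "B \<in> p" "x \<in> B"
    then show "map_prod id (\<lambda>j. map (\<lambda>j. 2 * j) [0..<k] ! j) x = map_prod id (interleave k) x"
      using parts_block_subset[OF p] by (fastforce simp: interleave_def)
  qed
  have odd: "{i. i < 2 * k \<and> i \<notin> set (map (\<lambda>j. 2 * j) [0..<k])} = (\<lambda>i. Suc (2 * i)) ` {..<k}"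
    (is "?L = ?R")
  proof
    show "?L \<subseteq> ?R"
    proof
      fix i assume i: "i \<in> ?L"
      have "odd i"
      proof
        assume "even i"
        then obtain j where "i = 2 * j" by blast
        then show False using i by auto
      qed
      then obtain j where "i = Suc (2 * j)" by (metis oddE Suc_eq_plus1)
      then show "i \<in> ?R" using i by auto
    qed
    show "?R \<subseteq> ?L" by auto presburger
  qed
  have "{{(Top, i), (Bot, i)} |i. i < 2 * k \<and> i \<notin> set (map (\<lambda>j. 2 * j) [0..<k])}
     = (\<lambda>i. {(Top, i), (Bot, i)}) ` {i. i < 2 * k \<and> i \<notin> set (map (\<lambda>j. 2 * j) [0..<k])}" by blast
  also have "\<dots> = (\<lambda>i. {(Top, Suc (2 * i)), (Bot, Suc (2 * i))}) ` {..<k}"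
    unfolding odd image_image ..
  also have "\<dots> = relabel id (interleave k) (relabel id (\<lambda>i. k + i) (ident k))"
    unfolding relabel_def ident_def perm_part_image image_image
    by (rule image_cong) (auto simp: interleave_def)
  finally show ?thesis
    using p unfolding insert_part_def 1 by (simp add: tensor_def relabel_def image_Un)
qed

lemma swap_pairs_involution:
  fixes k i :: nat
  defines "s \<equiv> \<lambda>i. if i < 2 * k then if even i then Suc i else i - 1 else i"
  shows "s (s i) = i"
proof (cases "even i")
  case True
  then show ?thesis unfolding s_def by (auto elim!: evenE)
next
  case False
  then show ?thesis unfolding s_def by (auto elim!: oddE)
qed

lemma swap_pairs_permutes:
  fixes k :: nat
  shows "(\<lambda>i. if i < 2 * k then if even i then Suc i else i - 1 else i) permutes {..<2 * k}"
    (is "?s permutes _")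
proof (rule inj_imp_permutes)
  show "inj_on ?s {..<2 * k}" by (rule inj_on_inverseI[of _ ?s]) (rule swap_pairs_involution)
  show "?s i \<in> {..<2 * k}" if "i \<in> {..<2 * k}" for i using that by (auto elim!: evenE)
qed auto

text \<open>Conjugated by the interleaving, the transpositions of neighbours that come from the words
  become the permutation \<open>\<tau>\<close>, which exchanges the two halves.\<close>

lemma twist_eq_relabel:
  assumes p: "p \<in> parts k"
  shows "relabel id (uninterleave k)
      (insert_part (2 * k) (map (\<lambda>j. 2 * j) [0..<k]) p \<circ>\<^sub>P perm_part (2 * k) (word_cycles (replicate k 2)))
    = twist k p"
proof -
  let ?s = "\<lambda>i. if i < 2 * k then if even i then Suc i else i - 1 else i"
  note ss = swap_pairs_involution[where k = k] and perm = swap_pairs_permutes[of k]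
  have "?s \<circ> ?s = id"
  proof
    fix i show "(?s \<circ> ?s) i = id i" unfolding o_apply id_apply by (rule ss)
  qed
  then have inv: "inv ?s = ?s" using inv_unique_comp by blast
  let ?X = "p \<otimes>\<^sub>P ident k"
  have X: "?X \<in> parts (2 * k)" by (rule tensor_parts_double[OF p ident_parts])
  have "insert_part (2 * k) (map (\<lambda>j. 2 * j) [0..<k]) p \<circ>\<^sub>P perm_part (2 * k) ?s
     = (`) (\<lambda>(r, i). (r, if r = Top then ?s i else i)) ` relabel id (interleave k) ?X"
    unfolding insert_part_even[OF p]
    using part_comp_perm[OF relabel_perm_parts[OF interleave_permutes X] perm] unfolding inv .
  moreover have "relabel id (uninterleave k) ((`) (\<lambda>(r, i). (r, if r = Top then ?s i else i)) ` relabel id (interleave k) ?X)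
     = twist k p"
    unfolding twist_eq_image[OF p] relabel_def image_image
  proof (rule image_cong[OF refl], rule image_cong[OF refl])
    fix B x assume "B \<in> ?X" "x \<in> B"
    then obtain r i where x: "x = (r, i)" "i < 2 * k" using parts_block_subset[OF X] by blast
    have "uninterleave k (?s (interleave k i)) = (if i < k then k + i else if i < 2 * k then i - k else i)"
      using x(2) by (auto simp: uninterleave_def interleave_def)
    then show "map_prod id (uninterleave k) (case map_prod id (interleave k) x of (r, i) \<Rightarrow> (r, if r = Top then ?s i else i))
      = (case x of (r, i) \<Rightarrow> (r, if r = Top then if i < k then k + i else if i < 2 * k then i - k else i else i))"
      using x(1) by (simp add: uninterleave_interleave)
  qed
  ultimately show ?thesis unfolding word_cycles_pairs by simp
qed

lemma concat_replicate_pair: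
  "concat (replicate k [a, b]) = map (\<lambda>i. if even i then a else b) [0..<2 * k]"
proof (induction k)
  case (Suc k)
  have "replicate (Suc k) [a, b] = replicate k [a, b] @ [[a, b]]"
    by (simp add: replicate_append_same)
  then have "concat (replicate (Suc k) [a, b]) = concat (replicate k [a, b]) @ [a, b]"
    by (simp del: replicate_Suc)
  then show ?case using Suc by simp
qed simp

lemma (in P_tracial_algebra) moment_product:
  assumes p: "p \<in> parts k"
  shows "m p (replicate k (a * b)) = m (twist k p) (replicate k a @ replicate k b)"
proof -
  let ?xss = "replicate k [a, b]"
  let ?Q = "insert_part (2 * k) (map (\<lambda>j. 2 * j) [0..<k]) p \<circ>\<^sub>P perm_part (2 * k) (word_cycles (replicate k 2))"
  have "map (word_start (replicate k 2)) [0..<k] = map (\<lambda>j. 2 * j) [0..<k]"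
    by (rule map_cong[OF refl]) (simp add: word_start_replicate)
  moreover have "map word_prod ?xss = replicate k (a * b)" by (simp add: word_prod_def)
  moreover have "m p (map word_prod ?xss)
     = m (insert_part (2 * k) (map (word_start (replicate k 2)) [0..<k]) p \<circ>\<^sub>P perm_part (2 * k) (word_cycles (replicate k 2))) (concat ?xss)"
    by (rule m_prod[OF p]) (simp_all add: sum_list_replicate)
  ultimately have "m p (replicate k (a * b)) = m ?Q (concat ?xss)" by (simp only:)
  also have "\<dots> = m (twist k p) (permute_list (interleave k) (concat ?xss))"
  proof -
    have Q: "?Q \<in> parts (2 * k)"
    proof (rule comp_part_parts)
      show "insert_part (2 * k) (map (\<lambda>j. 2 * j) [0..<k]) p \<in> parts (2 * k)"
        unfolding insert_part_even[OF p]
        by (rule relabel_perm_parts[OF interleave_permutes tensor_parts_double[OF p ident_parts]])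
      show "perm_part (2 * k) (word_cycles (replicate k 2)) \<in> parts (2 * k)"
        unfolding word_cycles_pairs
        by (rule perm_part_parts[OF swap_pairs_permutes])
    qed
    have "length (concat ?xss) = 2 * k" by (simp add: concat_replicate_pair)
    then show ?thesis
      using m_conj[OF Q _ uninterleave_permutes] conj_part_eq_relabel[OF uninterleave_permutes Q]
      by (simp add: conj_part_def deg_parts[OF Q] inv_uninterleave twist_eq_relabel[OF p])
  qed
  also have "permute_list (interleave k) (concat ?xss) = replicate k a @ replicate k b"
    by (rule nth_equalityI) (auto simp: concat_replicate_pair permute_list_def interleave_def nth_append)
  finally show ?thesis .
qed

context P_free_elements
begin

text \<open>Of the diagrams below \<open>twist k p\<close>, freeness keeps those that do not link the two halves. These are
  the tensor products.\<close>

lemma moment_of_product: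
  assumes p: "p \<in> parts k"
  shows "m p (replicate k (a * b)) = (\<Sum>(p1, p2) | p1 \<in> parts k \<and> p2 \<in> parts k \<and> p1 \<otimes>\<^sub>P p2 \<le>\<^sub>P twist k p.
     R_transform scale m a p1 * R_transform scale m b p2)"
proof -
  let ?w = "replicate k a @ replicate k b"
  let ?S = "{P \<in> parts (2 * k). P \<le>\<^sub>P twist k p}"
  let ?T = "{(p1, p2). p1 \<in> parts k \<and> p2 \<in> parts k \<and> p1 \<otimes>\<^sub>P p2 \<le>\<^sub>P twist k p}"
  let ?t = "\<lambda>(p1, p2). p1 \<otimes>\<^sub>P p2"
  have w: "?w = word (2 * k) {..<k}"
    by (rule nth_equalityI) (auto simp: word_def nth_append)
  have "m p (replicate k (a * b)) = (\<Sum>P\<in>?S. \<kappa> P ?w)"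
    unfolding moment_product[OF p] by (subst moment_cumulant[OF twist_parts[OF p]]) simp_all
  also have "\<dots> = (\<Sum>P\<in>?t ` ?T. \<kappa> P ?w)"
  proof (rule sum.mono_neutral_right)
    show "finite ?S" using finite_parts by simp
    show "?t ` ?T \<subseteq> ?S" using tensor_parts_double by auto
    show "\<forall>P\<in>?S - ?t ` ?T. \<kappa> P ?w = 0"
    proof
      fix P assume P: "P \<in> ?S - ?t ` ?T"
      have "\<not> splits P {..<k}"
      proof
        assume "splits P {..<k}"
        then obtain p1 p2 where "p1 \<in> parts k" "p2 \<in> parts k" "P = p1 \<otimes>\<^sub>P p2"
          using splits_lessThan_imp_tensor P by blast
        then have "P \<in> ?t ` ?T" using P by (intro image_eqI[of _ _ "(p1, p2)"]) auto
        then show False using P by blast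
      qed
      then show "\<kappa> P ?w = 0" unfolding w using P by (intro cumulant_vanishes) auto
    qed
  qed
  also have "\<dots> = (\<Sum>x\<in>?T. \<kappa> (?t x) ?w)"
  proof (rule sum.reindex[unfolded o_def], rule inj_onI, clarify)
    fix p1 p2 q1 q2
    assume "p1 \<in> parts k" "p2 \<in> parts k" "q1 \<in> parts k" "q2 \<in> parts k" "p1 \<otimes>\<^sub>P p2 = q1 \<otimes>\<^sub>P q2"
    then show "p1 = q1 \<and> p2 = q2" by (intro tensor_inject[of p1 k q1 p2 k q2])
  qed
  also have "\<dots> = (\<Sum>(p1, p2)\<in>?T. R_transform scale m a p1 * R_transform scale m b p2)"
    by (rule sum.cong[OF refl]) (auto simp: cumulant_tensor)
  finally show ?thesis .
qed

lemma boxtimes_eq: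
  assumes r: "r \<in> parts k"
  shows "(R_transform scale m a \<boxtimes> R_transform scale m b) r
    = (\<Sum>(p1, p2) | p1 \<in> parts k \<and> p2 \<in> parts k \<and> p1 \<circ>\<^sub>P p2 = r \<and> p1 \<otimes>\<^sub>P p2 \<le>\<^sub>P twist k r.
        R_transform scale m a p1 * R_transform scale m b p2)"
proof -
  let ?f = "\<lambda>p1 p2. R_transform scale m a p1 * R_transform scale m b p2"
  have K: "K_set r p1 = {p2 \<in> parts k. p1 \<circ>\<^sub>P p2 = r \<and> p1 \<otimes>\<^sub>P p2 \<le>\<^sub>P twist k r}" for p1
    unfolding K_set_def deg_parts[OF r] twist_def ..
  have finK: "finite (K_set r p1)" for p1 unfolding K using finite_parts by simp
  have "(R_transform scale m a \<boxtimes> R_transform scale m b) r = (\<Sum>p1 | p1 \<prec>\<^sub>P r. \<Sum>p2\<in>K_set r p1. ?f p1 p2)"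
    using r by (auto simp: boxtimes_def all_parts_def)
  also have "\<dots> = (\<Sum>p1\<in>parts k. \<Sum>p2\<in>K_set r p1. ?f p1 p2)"
    by (rule sum.mono_neutral_left) (auto simp: prec_part_def deg_parts[OF r] finite_parts)
  also have "\<dots> = (\<Sum>(p1, p2)\<in>(SIGMA p1:parts k. K_set r p1). ?f p1 p2)"
    by (rule sum.Sigma) (simp_all add: finite_parts finK)
  also have "(SIGMA p1:parts k. K_set r p1)
     = {(p1, p2). p1 \<in> parts k \<and> p2 \<in> parts k \<and> p1 \<circ>\<^sub>P p2 = r \<and> p1 \<otimes>\<^sub>P p2 \<le>\<^sub>P twist k r}"
    unfolding K by blast
  finally show ?thesis .
qed

theorem R_transform_mult:
  "R_transform scale m (a * b) = R_transform scale m a \<boxtimes> R_transform scale m b"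
proof
  fix p
  let ?RR = "R_transform scale m a \<boxtimes> R_transform scale m b"
  show "R_transform scale m (a * b) p = ?RR p"
  proof (cases "p \<in> all_parts")
    case True
    then obtain k where p: "p \<in> parts k" by (auto simp: all_parts_def)
    let ?f = "\<lambda>(p1, p2). R_transform scale m a p1 * R_transform scale m b p2"
    have "R_transform scale m (a * b) p + (\<Sum>q\<in>below k p. R_transform scale m (a * b) q)
        = ?RR p + (\<Sum>q\<in>below k p. ?RR q)" if p: "p \<in> parts k" for p
    proof -
      let ?S = "{(p1, p2). p1 \<in> parts k \<and> p2 \<in> parts k \<and> p1 \<otimes>\<^sub>P p2 \<le>\<^sub>P twist k p}"
      let ?T = "{r \<in> parts k. r \<le>\<^sub>P p}"
      have finS: "finite ?S"
        by (rule finite_subset[of _ "parts k \<times> parts k"]) (auto simp: finite_parts)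
      have "(\<Sum>r\<in>?T. R_transform scale m (a * b) r) = (\<Sum>r\<in>?T. \<kappa> r (replicate k (a * b)))"
        by (rule sum.cong) (simp_all add: R_transform_eq)
      also have "\<dots> = m p (replicate k (a * b))"
        by (rule moment_cumulant[OF p, symmetric]) simp
      also have "\<dots> = (\<Sum>x\<in>?S. ?f x)" by (rule moment_of_product[OF p])
      also have "\<dots> = (\<Sum>r\<in>?T. \<Sum>x\<in>{x \<in> ?S. (\<lambda>(p1, p2). p1 \<circ>\<^sub>P p2) x = r}. ?f x)"
      proof (rule sum.group[symmetric])
        show "finite ?T" using finite_parts by simp
        show "(\<lambda>(p1, p2). p1 \<circ>\<^sub>P p2) ` ?S \<subseteq> ?T"
        proof (rule image_subsetI, clarify)
          fix p1 p2 assume "p1 \<in> parts k" "p2 \<in> parts k" "p1 \<otimes>\<^sub>P p2 \<le>\<^sub>P twist k p"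
          then show "p1 \<circ>\<^sub>P p2 \<in> parts k \<and> p1 \<circ>\<^sub>P p2 \<le>\<^sub>P p"
            using tensor_le_twist_iff[OF _ _ p] comp_part_parts by simp
        qed
      qed (rule finS)
      also have "\<dots> = (\<Sum>r\<in>?T. ?RR r)"
      proof (rule sum.cong[OF refl])
        fix r assume r: "r \<in> ?T"
        then have "{x \<in> ?S. (\<lambda>(p1, p2). p1 \<circ>\<^sub>P p2) x = r}
          = {(p1, p2). p1 \<in> parts k \<and> p2 \<in> parts k \<and> p1 \<circ>\<^sub>P p2 = r \<and> p1 \<otimes>\<^sub>P p2 \<le>\<^sub>P twist k r}"
          using tensor_le_twist_iff[OF _ _ p] by auto
        then show "(\<Sum>x\<in>{x \<in> ?S. (\<lambda>(p1, p2). p1 \<circ>\<^sub>P p2) x = r}. ?f x) = ?RR r"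
          using boxtimes_eq[of r k] r by simp
      qed
      finally show ?thesis by (simp add: sum_le_part[OF p])
    qed
    then show ?thesis using triangular_unique[of k "R_transform scale m (a * b)" ?RR, OF _ p] by blast
  qed (simp add: R_transform_def boxtimes_def)
qed

end

theorem theorem2p3:
  fixes scale :: "complex \<Rightarrow> 'a::ring \<Rightarrow> 'a"
    and m :: "diagram \<Rightarrow> 'a list \<Rightarrow> complex"
    and a b :: 'a
  assumes "P_tracial_algebra scale m"
    and "P_free scale m a b"
  shows "R_transform scale m (a + b) = R_transform scale m a \<boxplus> R_transform scale m b \<and>
         R_transform scale m (a * b) = R_transform scale m a \<boxtimes> R_transform scale m b"
proof -
  interpret P_tracial_algebra scale m by (rule assms(1))
  interpret P_free_elements scale m a b by unfold_locales (rule assms(2))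
  show ?thesis using R_transform_add R_transform_mult by blast
qed

end
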